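(* Let $\epsilon>0$. Let $w_1,\ldots,w_m:(-\epsilon,\epsilon)\to\mathbb C\setminus\{0\}$ and $u:(-\epsilon,\epsilon)\to\mathbb R$ be differentiable functions. Consider the equations \[\text{(A)}\quad \frac{dw_j}{dt}=a_j\,\overline{w_1\cdots w_{j-1}w_{j+1}\cdots w_m}\quad(j=1,\ldots,m),\] \[\text{(B)}\quad \frac{du}{dt}=2\,\mathrm{Re}(w_1\cdots w_m),\] \[\text{(C)}\quad |w_j|^2=a_ju+1\quad(j=1,\ldots,m).\] (i) If (A) and (B) hold for all $t\in(-\epsilon,\epsilon)$ and (C) holds at $t=0$, then (C) holds for all $t\in(-\epsilon,\epsilon)$. (ii) Suppose (A), (B) and (C) hold for all $t\in(-\epsilon,\epsilon)$. Define $N\subset\mathbb C^m$ to be the set of points $\bigl(re^{i\alpha_1}w_1(t),\ldots,re^{i\alpha_m}w_m(t)\bigr)$ with $r>0$, $t\in(-\epsilon,\epsilon)$, $\alpha_j\in\mathbb R$, $\alpha_1+\cdots+\alpha_m=0$ and $a_1\alpha_1+\cdots+a_m\alpha_m=0$. Then $N$ is a special Lagrangian submanifold of $\mathbb C^m$ with phase $i^{m-2}$.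
   Context: Standing assumptions: $m\ge3$, and $a_1\le\cdots\le a_m$ are integers, not all zero, with highest common factor $1$ and $a_1+\cdots+a_m=0$. $\mathbb C^m$ carries the metric $g=\sum_j|dz_j|^2$, the Kähler form $\omega=\frac i2\sum_j dz_j\wedge d\bar z_j$ and $\Omega=dz_1\wedge\cdots\wedge dz_m$. An oriented real $m$-dimensional submanifold $L$ is special Lagrangian with phase $e^{i\theta}$ if $(\cos\theta\,\mathrm{Re}\,\Omega+\sin\theta\,\mathrm{Im}\,\Omega)|_L$ equals the induced volume form. *)

theory Defs
  imports "HOL-Analysis.Analysis"
begin

fun iter_deriv :: "('a::real_normed_vector \<Rightarrow> 'b::real_normed_vector) \<Rightarrow> 'a list \<Rightarrow> 'a \<Rightarrow> 'b" where
  "iter_deriv f [] = f"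
| "iter_deriv f (v # vs) = (\<lambda>x. frechet_derivative (iter_deriv f vs) (at x) v)"

definition smooth_on :: "'a::real_normed_vector set \<Rightarrow> ('a \<Rightarrow> 'b::real_normed_vector) \<Rightarrow> bool" where
  "smooth_on V f \<longleftrightarrow> (\<forall>vs. iter_deriv f vs differentiable_on V)"

definition chart :: "(complex^'m) set \<Rightarrow> (real^'m \<Rightarrow> complex^'m) \<Rightarrow> (real^'m) set \<Rightarrow> bool" where
  "chart L \<phi> V \<longleftrightarrow> open V \<and> smooth_on V \<phi> \<and>
     (\<forall>x\<in>V. inj (frechet_derivative \<phi> (at x))) \<and>
     (\<exists>U \<psi>. open U \<and> homeomorphism V (L \<inter> U) \<phi> \<psi>)"

definition frame :: "(real^'m \<Rightarrow> complex^'m) \<Rightarrow> real^'m \<Rightarrow> 'm \<Rightarrow> complex^'m" where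
  "frame \<phi> x i = frechet_derivative \<phi> (at x) (axis i 1)"

text \<open>Omega = dz_1 \<and> ... \<and> dz_m evaluated on m vectors of C^m.\<close>
definition holo_vol :: "('m::finite \<Rightarrow> complex^'m) \<Rightarrow> complex" where
  "holo_vol v = det (\<chi> k j. v j $ k)"

text \<open>The induced (Riemannian) volume form of g evaluated on m tangent vectors,
  positively oriented: sqrt of the Gram determinant.\<close>
definition induced_vol :: "('m::finite \<Rightarrow> complex^'m) \<Rightarrow> real" where
  "induced_vol v = sqrt (det (\<chi> i j. v i \<bullet> v j))"

definition oriented_atlas :: "(complex^'m) set \<Rightarrow> ((real^'m \<Rightarrow> complex^'m) \<times> (real^'m) set) set \<Rightarrow> bool" where
  "oriented_atlas L A \<longleftrightarrow>
     (\<forall>(\<phi>,V)\<in>A. chart L \<phi> V) \<and>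
     (\<forall>p\<in>L. \<exists>(\<phi>,V)\<in>A. p \<in> \<phi> ` V) \<and>
     (\<forall>(\<phi>1,V1)\<in>A. \<forall>(\<phi>2,V2)\<in>A. \<forall>x1\<in>V1. \<forall>x2\<in>V2. \<phi>1 x1 = \<phi>2 x2 \<longrightarrow>
        (\<exists>M::real^'m^'m. det M > 0 \<and>
           (\<forall>i. frame \<phi>1 x1 i = (\<Sum>j\<in>UNIV. (M $ i $ j) *\<^sub>R frame \<phi>2 x2 j))))"

text \<open>L is an oriented real m-dimensional submanifold which is special Lagrangian with phase
  e^{i theta}: (cos theta Re Omega + sin theta Im Omega) restricted to L equals the induced
  volume form (checked on the positively oriented coordinate frames of an oriented atlas).\<close>
definition special_lagrangian_theta :: "(complex^'m) set \<Rightarrow> real \<Rightarrow> bool" where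
  "special_lagrangian_theta L \<theta> \<longleftrightarrow>
     (\<exists>A. oriented_atlas L A \<and>
        (\<forall>(\<phi>,V)\<in>A. \<forall>x\<in>V.
           cos \<theta> * Re (holo_vol (frame \<phi> x)) + sin \<theta> * Im (holo_vol (frame \<phi> x))
             = induced_vol (frame \<phi> x)))"

definition special_lagrangian :: "(complex^'m) set \<Rightarrow> complex \<Rightarrow> bool" where
  "special_lagrangian L \<zeta> \<longleftrightarrow> (\<exists>\<theta>. \<zeta> = exp (\<i> * of_real \<theta>) \<and> special_lagrangian_theta L \<theta>)"

end

theory Submission
  imports Defs
begin

text \<open>
  By (A), the derivative of \<open>|w_j|^2\<close> is \<open>2 a_j Re(w_1...w_m) = a_j u'\<close>, which gives (i).

  For (ii), parametrize \<open>N\<close> by the logarithm of the radius, the time and \<open>m - 2\<close> angles along an integral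
  basis of the admissible phases. The \<open>j\<close>-th coordinate of a tangent vector is \<open>z_j\<close> times a
  combination of \<open>1\<close>, \<open>cnj (w_1...w_m) a_j / |w_j|^2\<close> and \<open>i b_j\<close> with \<open>b\<close> orthogonal to
  \<open>(1, ..., 1)\<close> and \<open>a\<close>. By (C) these are pairwise Hermitian-orthogonal apart from the angular ones,
  whose Hermitian products are real, so the frame is Lagrangian and its volume is the modulus of
  \<open>\<Omega>\<close>; and \<open>\<Omega>\<close> is \<open>i^(m-2) |w_1...w_m|^2\<close> times a real factor of constant sign.

  The image is embedded because (A) is equivariant under phases of sum zero, so that by uniqueness the
  curve of orbits either is injective without accumulating on itself or is periodic.
\<close>

section \<open>Smoothness, determinants and immersions\<close>

lemma has_derivative_vec:
  fixes f :: "'a::real_normed_vector \<Rightarrow> 'b::real_normed_vector ^ 'n"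
  assumes "\<And>j. ((\<lambda>x. f x $ j) has_derivative (\<lambda>h. f' h $ j)) F"
  shows "(f has_derivative f') F"
proof -
  have ax: "bounded_linear (axis j :: 'b \<Rightarrow> 'b ^ 'n)" for j
    by (rule bounded_linear_intro[where K=1])
       (auto simp: axis_def vec_eq_iff norm_vec_def L2_set_def if_distrib[of norm]
          if_distrib[of "\<lambda>x. x ^ 2"] cong: if_cong)
  have eq: "y = (\<Sum>j\<in>UNIV. axis j (y $ j))" for y :: "'b ^ 'n"
    by (simp add: vec_eq_iff axis_def if_distrib cong: if_cong)
  have "((\<lambda>x. \<Sum>j\<in>UNIV. axis j (f x $ j)) has_derivative
         (\<lambda>h. \<Sum>j\<in>UNIV. axis j (f' h $ j))) F"
    by (intro has_derivative_sum bounded_linear.has_derivative[OF ax] assms)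
  then show ?thesis
    by (simp flip: eq)
qed

text \<open>By induction on the list of directions, every iterated derivative agrees on
  \<open>V\<close> with a member of the family. Openness of \<open>V\<close> lets this agreement
  pass to the next derivative, so one closure check replaces infinitely many differentiability
  checks.\<close>

lemma smooth_on_closed_family:
  fixes f :: "'a::real_normed_vector \<Rightarrow> 'b::real_normed_vector"
  assumes "open V" "f \<in> \<F>"
    and closed: "\<And>g. g \<in> \<F> \<Longrightarrow>
      \<exists>g'. (\<forall>v. g' v \<in> \<F>) \<and> (\<forall>x\<in>V. (g has_derivative (\<lambda>v. g' v x)) (at x))"
  shows "smooth_on V f"
proof -
  have deriv: "(h has_derivative g') (at x)"
    if "\<forall>x\<in>V. h x = g x" "(g has_derivative g') (at x)" "x \<in> V" for h g g' x
    using has_derivative_transform_within_open[OF that(2) \<open>open V\<close> that(3)] that(1) by metis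
  have agree: "\<exists>g\<in>\<F>. \<forall>x\<in>V. iter_deriv f vs x = g x" for vs
  proof (induction vs)
    case Nil
    then show ?case using \<open>f \<in> \<F>\<close> by auto
  next
    case (Cons v vs)
    then obtain g where g: "g \<in> \<F>" "\<forall>x\<in>V. iter_deriv f vs x = g x" by blast
    obtain g' where g': "\<forall>v. g' v \<in> \<F>" "\<forall>x\<in>V. (g has_derivative (\<lambda>v. g' v x)) (at x)"
      using closed[OF g(1)] by blast
    have "frechet_derivative (iter_deriv f vs) (at x) v = g' v x" if "x \<in> V" for x
      using frechet_derivative_at[OF deriv[OF g(2) g'(2)[rule_format, OF that] that]]
      by metis
    then show ?case using g'(1) by auto
  qed
  show ?thesis
    unfolding smooth_on_def
  proof
    fix vs
    obtain g where g: "g \<in> \<F>" "\<forall>x\<in>V. iter_deriv f vs x = g x" using agree by blast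
    obtain g' where g': "\<forall>x\<in>V. (g has_derivative (\<lambda>v. g' v x)) (at x)"
      using closed[OF g(1)] by blast
    show "iter_deriv f vs differentiable_on V"
      using deriv[OF g(2)] g' has_derivative_at_withinI
      unfolding differentiable_on_def differentiable_def by blast
  qed
qed

text \<open>The algebra of polynomial expressions in the generators with complex coefficients. A
  solution of a polynomial differential equation generates an algebra closed under differentiation,
  which yields smoothness.\<close>

inductive_set gen_algebra :: "('a \<Rightarrow> complex) set \<Rightarrow> ('a \<Rightarrow> complex) set" for G where
  const: "(\<lambda>x. c) \<in> gen_algebra G"
| gen: "g \<in> G \<Longrightarrow> g \<in> gen_algebra G"
| add: "f \<in> gen_algebra G \<Longrightarrow> g \<in> gen_algebra G \<Longrightarrow> (\<lambda>x. f x + g x) \<in> gen_algebra G"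
| mult: "f \<in> gen_algebra G \<Longrightarrow> g \<in> gen_algebra G \<Longrightarrow> (\<lambda>x. f x * g x) \<in> gen_algebra G"

lemma gen_algebra_prod:
  "(\<And>k. k \<in> K \<Longrightarrow> f k \<in> gen_algebra G) \<Longrightarrow> (\<lambda>x. \<Prod>k\<in>K. f k x) \<in> gen_algebra G"
  by (induction K rule: infinite_finite_induct)
     (auto intro!: gen_algebra.const gen_algebra.mult)

lemma gen_algebra_deriv:
  assumes gens: "\<And>g. g \<in> G \<Longrightarrow> \<exists>g'. (\<forall>v. g' v \<in> gen_algebra G) \<and>
      (\<forall>x\<in>V. (g has_derivative (\<lambda>v. g' v x)) (at x))"
    and "f \<in> gen_algebra G"
  shows "\<exists>f'. (\<forall>v. f' v \<in> gen_algebra G) \<and> (\<forall>x\<in>V. (f has_derivative (\<lambda>v. f' v x)) (at x))"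
  using assms(2)
proof induction
  case (const c)
  show ?case
    by (intro exI[of _ "\<lambda>v x. 0"]) (auto intro: gen_algebra.const)
next
  case (gen g)
  then show ?case using gens by blast
next
  case (add f g)
  then obtain f' g' where "\<forall>v. f' v \<in> gen_algebra G" "\<forall>v. g' v \<in> gen_algebra G"
    "\<forall>x\<in>V. (f has_derivative (\<lambda>v. f' v x)) (at x)"
    "\<forall>x\<in>V. (g has_derivative (\<lambda>v. g' v x)) (at x)"
    by blast
  then show ?case
    by (intro exI[of _ "\<lambda>v x. f' v x + g' v x"])
       (auto intro: gen_algebra.add has_derivative_add)
next
  case (mult f g)
  then obtain f' g' where "\<forall>v. f' v \<in> gen_algebra G" "\<forall>v. g' v \<in> gen_algebra G"
    "\<forall>x\<in>V. (f has_derivative (\<lambda>v. f' v x)) (at x)"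
    "\<forall>x\<in>V. (g has_derivative (\<lambda>v. g' v x)) (at x)"
    by blast
  then show ?case using mult.hyps
    by (intro exI[of _ "\<lambda>v x. f x * g' v x + f' v x * g x"])
       (auto intro!: gen_algebra.add gen_algebra.mult has_derivative_mult)
qed

lemma smooth_on_gen_algebra:
  fixes f :: "'a::real_normed_vector \<Rightarrow> complex ^ 'n"
  assumes "open V"
    and gens: "\<And>g. g \<in> G \<Longrightarrow> \<exists>g'. (\<forall>v. g' v \<in> gen_algebra G) \<and>
      (\<forall>x\<in>V. (g has_derivative (\<lambda>v. g' v x)) (at x))"
    and f: "\<And>j. (\<lambda>x. f x $ j) \<in> gen_algebra G"
  shows "smooth_on V f"
proof (rule smooth_on_closed_family[where \<F> = "{f. \<forall>j. (\<lambda>x. f x $ j) \<in> gen_algebra G}"])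
  fix g :: "'a \<Rightarrow> complex ^ 'n" assume "g \<in> {f. \<forall>j. (\<lambda>x. f x $ j) \<in> gen_algebra G}"
  then have "\<forall>j. \<exists>f'. (\<forall>v. f' v \<in> gen_algebra G) \<and>
      (\<forall>x\<in>V. ((\<lambda>x. g x $ j) has_derivative (\<lambda>v. f' v x)) (at x))"
    using gen_algebra_deriv[OF gens] by blast
  then obtain g' where "\<And>j v. g' j v \<in> gen_algebra G"
    "\<And>j x. x \<in> V \<Longrightarrow> ((\<lambda>x. g x $ j) has_derivative (\<lambda>v. g' j v x)) (at x)"
    by metis
  then show "\<exists>g'. (\<forall>v. g' v \<in> {f. \<forall>j. (\<lambda>x. f x $ j) \<in> gen_algebra G}) \<and>
      (\<forall>x\<in>V. (g has_derivative (\<lambda>v. g' v x)) (at x))"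
    by (intro exI[of _ "\<lambda>v x. \<chi> j. g' j v x"]) (auto intro!: has_derivative_vec)
qed (use assms in auto)

section \<open>Determinants of complex frames, the induced volume and calibration\<close>

lemma det_scale_rows_columns:
  fixes C :: "'a::comm_ring_1 ^ 'n ^ 'n"
  shows "det (\<chi> i j. d i * q j * C $ i $ j) = prod d UNIV * prod q UNIV * det C"
proof -
  have "(\<Prod>i\<in>UNIV. d i * q (\<pi> i) * C $ i $ \<pi> i) =
      prod d UNIV * prod q UNIV * (\<Prod>i\<in>UNIV. C $ i $ \<pi> i)" if "\<pi> permutes UNIV" for \<pi>
    using prod.permute[OF that, of q] by (simp add: prod.distrib comp_def)
  then show ?thesis
    by (simp add: det_def sum_distrib_left algebra_simps)
qed

lemma det_of_real:
  "det (\<chi> i j. of_real (A $ i $ j)) = (of_real (det A) :: 'a::{comm_ring_1,real_algebra_1})"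
  by (simp add: det_def)

lemma det_cnj: "det (\<chi> i j. cnj (A $ i $ j)) = cnj (det A)"
  by (simp add: det_def)

text \<open>When the Hermitian products of the frame are real they coincide with the Gram matrix,
  which is then the conjugate transpose of the frame matrix times that matrix. Its determinant is
  the squared modulus of the complex determinant.\<close>

lemma induced_vol_Lagrangian:
  fixes v :: "'m::finite \<Rightarrow> complex ^ 'm"
  assumes "\<And>i j. (\<Sum>k\<in>UNIV. cnj (v i $ k) * v j $ k) \<in> \<real>"
  shows "induced_vol v = cmod (holo_vol v)"
proof -
  define V :: "complex ^ 'm ^ 'm" where "V = (\<chi> k j. v j $ k)"
  have gram: "(\<Sum>k\<in>UNIV. cnj (v i $ k) * v j $ k) = of_real (v i \<bullet> v j)" for i j
  proof (rule complex_eqI)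
    show "Im (\<Sum>k\<in>UNIV. cnj (v i $ k) * v j $ k) = Im (of_real (v i \<bullet> v j))"
      using assms[of i j] unfolding complex_is_Real_iff by simp
  qed (simp add: inner_vec_def inner_complex_def)
  have "of_real (det (\<chi> i j. v i \<bullet> v j)) = det (transpose (\<chi> i j. cnj (V $ i $ j)) ** V)"
    unfolding det_of_real[symmetric] by (simp add: matrix_matrix_mult_def transpose_def V_def gram)
  also have "\<dots> = cnj (det V) * det V"
    by (simp add: det_mul det_cnj)
  also have "\<dots> = of_real ((cmod (det V))\<^sup>2)"
    unfolding complex_norm_square by (rule mult.commute)
  finally show ?thesis
    unfolding induced_vol_def holo_vol_def V_def[symmetric] of_real_eq_iff by simp
qed

lemma calibrated_Lagrangian:
  fixes v :: "'m::finite \<Rightarrow> complex ^ 'm"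
  assumes "\<And>i j. (\<Sum>k\<in>UNIV. cnj (v i $ k) * v j $ k) \<in> \<real>"
    and "holo_vol v = of_real R * exp (\<i> * of_real \<theta>)" "R \<ge> 0"
  shows "cos \<theta> * Re (holo_vol v) + sin \<theta> * Im (holo_vol v) = induced_vol v"
proof -
  have "cos \<theta> * Re (holo_vol v) + sin \<theta> * Im (holo_vol v) = R * ((sin \<theta>)\<^sup>2 + (cos \<theta>)\<^sup>2)"
    unfolding power2_eq_square by (simp add: assms(2) Re_exp Im_exp algebra_simps del: sin_cos_squared_add3)
  then show ?thesis
    using assms(3) induced_vol_Lagrangian[OF assms(1)] by (simp add: assms(2) norm_mult)
qed

lemma norm_prod_diff_bounded:
  fixes z w :: "'i \<Rightarrow> complex"
  assumes "M > 0" "\<And>i. i \<in> I \<Longrightarrow> cmod (z i) \<le> M" "\<And>i. i \<in> I \<Longrightarrow> cmod (w i) \<le> M"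
  shows "cmod ((\<Prod>i\<in>I. z i) - (\<Prod>i\<in>I. w i)) \<le> M ^ card I / M * (\<Sum>i\<in>I. cmod (z i - w i))"
proof -
  have scale: "(\<Prod>i\<in>I. f i) = of_real (M ^ card I) * (\<Prod>i\<in>I. f i / of_real M)" for f :: "'i \<Rightarrow> complex"
    using assms(1) by (simp add: prod_dividef)
  have "(\<Prod>i\<in>I. z i) - (\<Prod>i\<in>I. w i) =
      of_real (M ^ card I) * ((\<Prod>i\<in>I. z i / of_real M) - (\<Prod>i\<in>I. w i / of_real M))"
    by (simp only: right_diff_distrib flip: scale[of z] scale[of w])
  then have "cmod ((\<Prod>i\<in>I. z i) - (\<Prod>i\<in>I. w i)) =
      M ^ card I * cmod ((\<Prod>i\<in>I. z i / of_real M) - (\<Prod>i\<in>I. w i / of_real M))"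
    using assms(1) by (simp only: norm_mult norm_of_real abs_of_pos zero_less_power)
  also have "\<dots> \<le> M ^ card I * (\<Sum>i\<in>I. cmod (z i / of_real M - w i / of_real M))"
    using assms by (intro mult_left_mono norm_prod_diff) (auto simp: norm_divide)
  also have "(\<Sum>i\<in>I. cmod (z i / of_real M - w i / of_real M)) = (\<Sum>i\<in>I. cmod (z i - w i)) / M"
    using assms(1) by (simp add: norm_divide flip: diff_divide_distrib sum_divide_distrib)
  finally show ?thesis by simp
qed

text \<open>Injectivity near a point follows once the derivative varies continuously in operator
  norm. Only continuity of the finitely many columns is asked for, since these are explicit for a
  parametrization.\<close>

lemma immersion_locally_injective:
  fixes f :: "real ^ 'n \<Rightarrow> 'b::euclidean_space"
  assumes "open S" "x0 \<in> S"
    and der: "\<And>x. x \<in> S \<Longrightarrow> (f has_derivative f' x) (at x)"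
    and cont: "\<And>i. continuous (at x0) (\<lambda>x. f' x (axis i 1))"
    and "inj (f' x0)"
  obtains r where "r > 0" "ball x0 r \<subseteq> S" "inj_on f (ball x0 r)"
proof -
  have lin: "linear (f' x)" if "x \<in> S" for x
    using der[OF that] has_derivative_linear by blast
  obtain g where g: "linear g" "g \<circ> f' x0 = id"
    using linear_injective_left_inverse[OF lin[OF \<open>x0 \<in> S\<close>] \<open>inj (f' x0)\<close>] by blast
  have small: "\<exists>d>0. \<forall>x. dist x0 x < d \<longrightarrow> onorm (\<lambda>v. f' x v - f' x0 v) < e" if "e > 0" for e
  proof -
    \<comment> \<open>The total change of the columns dominates the operator norm of the change of
      the derivative, because each coordinate of a vector is at most its norm.\<close>
    define s where "s x = (\<Sum>i\<in>UNIV. norm (f' x (axis i 1) - f' x0 (axis i 1)))" for x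
    have "continuous (at x0) s" unfolding s_def by (intro continuous_intros cont)
    then obtain d1 where d1: "d1 > 0" "\<And>x. dist x x0 < d1 \<Longrightarrow> dist (s x) (s x0) < e"
      using \<open>e > 0\<close> unfolding continuous_at_eps_delta by blast
    obtain d2 where d2: "d2 > 0" "ball x0 d2 \<subseteq> S"
      using assms(1,2) openE by blast
    have "onorm (\<lambda>v. f' x v - f' x0 v) < e" if x: "dist x0 x < min d1 d2" for x
    proof -
      have "x \<in> S" using x d2 by auto
      have comb: "f' y v = (\<Sum>i\<in>UNIV. v $ i *\<^sub>R f' y (axis i 1))" if "y \<in> S" for y v
      proof -
        have "v = (\<Sum>i\<in>UNIV. v $ i *\<^sub>R axis i 1)"
          by (simp add: vec_eq_iff axis_def if_distrib cong: if_cong)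
        then have "f' y v = f' y (\<Sum>i\<in>UNIV. v $ i *\<^sub>R axis i 1)" by (rule arg_cong)
        also have "\<dots> = (\<Sum>i\<in>UNIV. v $ i *\<^sub>R f' y (axis i 1))"
          using lin[OF that] by (simp add: linear_sum linear_scale)
        finally show ?thesis .
      qed
      have "norm (f' x v - f' x0 v) \<le> s x * norm v" for v
      proof -
        have "f' x v - f' x0 v = (\<Sum>i\<in>UNIV. v $ i *\<^sub>R (f' x (axis i 1) - f' x0 (axis i 1)))"
          unfolding comb[OF \<open>x \<in> S\<close>, of v] comb[OF \<open>x0 \<in> S\<close>, of v]
          by (simp add: sum_subtractf scaleR_diff_right)
        then have "norm (f' x v - f' x0 v) \<le> (\<Sum>i\<in>UNIV. norm v * norm (f' x (axis i 1) - f' x0 (axis i 1)))"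
          using component_le_norm_cart[of v]
          by (auto intro!: order_trans[OF norm_sum] sum_mono mult_right_mono)
        then show ?thesis by (simp add: s_def sum_distrib_left[symmetric] mult.commute)
      qed
      then have "onorm (\<lambda>v. f' x v - f' x0 v) \<le> s x"
        by (rule onorm_le)
      also have "\<dots> < e" using d1(2)[of x] x by (simp add: s_def dist_commute dist_real_def)
      finally show ?thesis .
    qed
    then show ?thesis using d1(1) d2(1) by (intro exI[of _ "min d1 d2"]) auto
  qed
  show ?thesis
    by (rule has_derivative_locally_injective[where f'=f', OF assms(2,1) _ g(2) der small])
       (use g linear_conv_bounded_linear that in auto)
qed

section \<open>The flow\<close>

text \<open>The integrating factor \<open>exp (- K * x)\<close> makes the function nonincreasing for
  positive times, and \<open>exp (K * x)\<close> makes it nondecreasing for negative ones.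
  Derivatives are required only inside the segment, so an end may be a boundary time of the
  flow.\<close>

lemma gronwall_zero:
  fixes h :: "real \<Rightarrow> real"
  assumes "continuous_on (closed_segment 0 s) h"
    and der: "\<And>x. x \<in> open_segment 0 s \<Longrightarrow> (h has_real_derivative h' x) (at x)"
    and bound: "\<And>x. x \<in> open_segment 0 s \<Longrightarrow> \<bar>h' x\<bar> \<le> K * h x"
    and "h 0 = 0"
  shows "h s \<le> 0"
proof (cases "s \<ge> 0")
  case True
  have "exp (- K * s) * h s \<le> exp (- K * 0) * h 0"
  proof (rule DERIV_nonpos_imp_decreasing_open[OF True])
    fix x assume "0 < x" "x < s"
    then have x: "x \<in> open_segment 0 s" by (simp add: open_segment_eq_real_ivl)
    have "((\<lambda>x. exp (- K * x) * h x) has_real_derivative exp (- K * x) * (h' x - K * h x)) (at x)"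
      by (auto intro!: derivative_eq_intros der[OF x] simp: algebra_simps)
    moreover have "exp (- K * x) * (h' x - K * h x) \<le> 0"
      using bound[OF x] by (simp add: mult_le_0_iff)
    ultimately show "\<exists>y. ((\<lambda>x. exp (- K * x) * h x) has_real_derivative y) (at x) \<and> y \<le> 0"
      by blast
  next
    show "continuous_on {0..s} (\<lambda>x. exp (- K * x) * h x)"
      using assms(1) True by (auto intro!: continuous_intros simp: closed_segment_eq_real_ivl)
  qed
  then show ?thesis using \<open>h 0 = 0\<close> by (simp add: mult_le_0_iff)
next
  case False
  then have "s \<le> 0" by simp
  have "exp (K * s) * h s \<le> exp (K * 0) * h 0"
  proof (rule DERIV_nonneg_imp_increasing_open[OF \<open>s \<le> 0\<close>])
    fix x assume "s < x" "x < 0"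
    then have x: "x \<in> open_segment 0 s" by (simp add: open_segment_eq_real_ivl)
    have "((\<lambda>x. exp (K * x) * h x) has_real_derivative exp (K * x) * (h' x + K * h x)) (at x)"
      by (auto intro!: derivative_eq_intros der[OF x] simp: algebra_simps)
    moreover have "exp (K * x) * (h' x + K * h x) \<ge> 0"
      using bound[OF x] by (simp add: zero_le_mult_iff)
    ultimately show "\<exists>y. ((\<lambda>x. exp (K * x) * h x) has_real_derivative y) (at x) \<and> 0 \<le> y"
      by blast
  next
    show "continuous_on {s..0} (\<lambda>x. exp (K * x) * h x)"
      using assms(1) False by (auto intro!: continuous_intros simp: closed_segment_eq_real_ivl)
  qed
  then show ?thesis using \<open>h 0 = 0\<close> by (simp add: mult_le_0_iff)
qed

lemma norm_square_has_real_derivative: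
  fixes f :: "real \<Rightarrow> 'a::real_inner"
  assumes "(f has_vector_derivative f') (at x)"
  shows "((\<lambda>x. (norm (f x))\<^sup>2) has_real_derivative 2 * (f x \<bullet> f')) (at x)"
  unfolding has_field_derivative_def power2_norm_eq_inner
  using has_derivative_inner[OF assms[unfolded has_vector_derivative_def] assms[unfolded has_vector_derivative_def]]
  by (rule has_derivative_eq_rhs) (auto simp: fun_eq_iff inner_commute)

section \<open>The vector field of equation (A): uniqueness and conservation\<close>

definition flow_field :: "('m::finite \<Rightarrow> int) \<Rightarrow> ('m \<Rightarrow> complex) \<Rightarrow> 'm \<Rightarrow> complex" where
  "flow_field a z j = of_int (a j) * cnj (\<Prod>k\<in>UNIV-{j}. z k)"

lemma flow_field_lipschitz:
  fixes a :: "'m::finite \<Rightarrow> int"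
  assumes "M > 0"
  obtains K where "K \<ge> 0"
    "\<And>z w j. (\<And>k. cmod (z k) \<le> M) \<Longrightarrow> (\<And>k. cmod (w k) \<le> M) \<Longrightarrow>
      cmod (flow_field a z j - flow_field a w j) \<le> K * (\<Sum>k\<in>UNIV. cmod (z k - w k))"
proof
  define N where "N = CARD('m) - 1"
  \<comment> \<open>Summing all the weights gives one constant that serves every coordinate
    \<open>j\<close>.\<close>
  let ?K = "(\<Sum>j\<in>UNIV. \<bar>real_of_int (a j)\<bar>) * (M ^ N / M)"
  show "?K \<ge> 0" using assms by (simp add: sum_nonneg)
  fix z w :: "'m \<Rightarrow> complex" and j
  assume z: "\<And>k. cmod (z k) \<le> M" and w: "\<And>k. cmod (w k) \<le> M"
  have "cmod (flow_field a z j - flow_field a w j) =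
      \<bar>real_of_int (a j)\<bar> * cmod ((\<Prod>k\<in>UNIV-{j}. z k) - (\<Prod>k\<in>UNIV-{j}. w k))"
    unfolding flow_field_def right_diff_distrib[symmetric] complex_cnj_diff[symmetric]
      norm_mult complex_mod_cnj by simp
  also have "\<dots> \<le> (\<Sum>j\<in>UNIV. \<bar>real_of_int (a j)\<bar>) *
      (M ^ card (UNIV - {j}) / M * (\<Sum>k\<in>UNIV-{j}. cmod (z k - w k)))"
    using z w assms by (intro mult_mono norm_prod_diff_bounded member_le_sum) (auto simp: sum_nonneg)
  also have "\<dots> \<le> (\<Sum>j\<in>UNIV. \<bar>real_of_int (a j)\<bar>) * (M ^ card (UNIV - {j}) / M * (\<Sum>k\<in>UNIV. cmod (z k - w k)))"
    using assms by (intro mult_left_mono sum_mono2) (auto simp: sum_nonneg)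
  finally show "cmod (flow_field a z j - flow_field a w j) \<le> ?K * (\<Sum>k\<in>UNIV. cmod (z k - w k))"
    by (simp add: N_def card_Diff_singleton mult.assoc)
qed

text \<open>Gronwall is applied to the squared distance of the two solutions. The equation is
  assumed only inside the segment, with continuity up to its ends, so that solutions can be compared
  starting from a boundary time.\<close>

lemma flow_unique:
  fixes f g :: "'m::finite \<Rightarrow> real \<Rightarrow> complex"
  assumes cont: "\<And>j. continuous_on (closed_segment 0 s) (f j)" "\<And>j. continuous_on (closed_segment 0 s) (g j)"
    and ode: "\<And>x j. x \<in> open_segment 0 s \<Longrightarrow>
        (f j has_vector_derivative flow_field a (\<lambda>k. f k x) j) (at x)"
      "\<And>x j. x \<in> open_segment 0 s \<Longrightarrow>
        (g j has_vector_derivative flow_field a (\<lambda>k. g k x) j) (at x)"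
    and bound: "\<And>x j. x \<in> open_segment 0 s \<Longrightarrow> cmod (f j x) \<le> M"
      "\<And>x j. x \<in> open_segment 0 s \<Longrightarrow> cmod (g j x) \<le> M"
    and "\<And>j. f j 0 = g j 0"
  shows "f j s = g j s"
proof -
  \<comment> \<open>The bound \<open>M\<close> need not be positive when the open segment is empty,
    while the Lipschitz estimate asks for a positive radius.\<close>
  define M1 where "M1 = max M 1"
  have "M1 > 0" by (simp add: M1_def)
  obtain K where K: "K \<ge> 0"
    "\<And>z w j. (\<And>k. cmod (z k) \<le> M1) \<Longrightarrow> (\<And>k. cmod (w k) \<le> M1) \<Longrightarrow>
      cmod (flow_field a z j - flow_field a w j) \<le> K * (\<Sum>k\<in>UNIV. cmod (z k - w k))"
    using flow_field_lipschitz[OF \<open>M1 > 0\<close>, where a=a] by blast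
  define \<delta> where "\<delta> x j = f j x - g j x" for x j
  define \<eta> where "\<eta> x j = flow_field a (\<lambda>k. f k x) j - flow_field a (\<lambda>k. g k x) j" for x j
  have "(\<Sum>j\<in>UNIV. (cmod (\<delta> s j))\<^sup>2) \<le> 0"
  proof (rule gronwall_zero[where h = "\<lambda>x. \<Sum>j\<in>UNIV. (cmod (\<delta> x j))\<^sup>2" and h' = "\<lambda>x. \<Sum>j\<in>UNIV. 2 * (\<delta> x j \<bullet> \<eta> x j)" and K = "2 * K * CARD('m)"])
    show "continuous_on (closed_segment 0 s) (\<lambda>x. \<Sum>j\<in>UNIV. (cmod (\<delta> x j))\<^sup>2)"
      unfolding \<delta>_def by (intro continuous_intros cont)
    show "(\<Sum>j\<in>UNIV. (cmod (\<delta> 0 j))\<^sup>2) = 0"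
      using assms(7) by (simp add: \<delta>_def)
  next
    fix x assume x: "x \<in> open_segment 0 s"
    show "((\<lambda>x. \<Sum>j\<in>UNIV. (cmod (\<delta> x j))\<^sup>2) has_real_derivative (\<Sum>j\<in>UNIV. 2 * (\<delta> x j \<bullet> \<eta> x j))) (at x)"
      unfolding \<delta>_def \<eta>_def
      by (intro DERIV_sum norm_square_has_real_derivative has_vector_derivative_diff ode x)
    define S where "S = (\<Sum>k\<in>UNIV. cmod (\<delta> x k))"
    have \<eta>: "cmod (\<eta> x j) \<le> K * S" for j
      unfolding \<eta>_def S_def \<delta>_def
      by (rule K(2)) (use bound x in \<open>auto simp: M1_def le_max_iff_disj\<close>)
    have "\<bar>\<Sum>j\<in>UNIV. 2 * (\<delta> x j \<bullet> \<eta> x j)\<bar> \<le> (\<Sum>j\<in>UNIV. 2 * (cmod (\<delta> x j) * (K * S)))"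
    proof (intro order_trans[OF sum_abs] sum_mono)
      fix j
      have "\<bar>\<delta> x j \<bullet> \<eta> x j\<bar> \<le> cmod (\<delta> x j) * cmod (\<eta> x j)"
        by (rule Cauchy_Schwarz_ineq2)
      also have "\<dots> \<le> cmod (\<delta> x j) * (K * S)"
        using \<eta> by (intro mult_left_mono) auto
      finally show "\<bar>2 * (\<delta> x j \<bullet> \<eta> x j)\<bar> \<le> 2 * (cmod (\<delta> x j) * (K * S))" by simp
    qed
    also have "\<dots> = 2 * K * S\<^sup>2"
      by (simp add: S_def power2_eq_square sum_distrib_left[symmetric] sum_distrib_right[symmetric])
    \<comment> \<open>Cauchy-Schwarz bounds the square of the sum by \<open>CARD('m)\<close> times
      the sum of squares; hence this factor in the Gronwall constant.\<close>
    also have "\<dots> \<le> 2 * K * (CARD('m) * (\<Sum>j\<in>UNIV. (cmod (\<delta> x j))\<^sup>2))"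
      unfolding S_def using K(1) sum_squared_le_sum_of_squares[of "\<lambda>k. cmod (\<delta> x k)" UNIV]
      by (intro mult_left_mono) (auto simp: mult.commute)
    finally show "\<bar>\<Sum>j\<in>UNIV. 2 * (\<delta> x j \<bullet> \<eta> x j)\<bar> \<le> 2 * K * CARD('m) * (\<Sum>j\<in>UNIV. (cmod (\<delta> x j))\<^sup>2)"
      by (simp add: mult.assoc)
  qed
  then have "(\<Sum>j\<in>UNIV. (cmod (\<delta> s j))\<^sup>2) = 0"
    by (meson antisym sum_nonneg zero_le_power2)
  then show ?thesis
    by (simp add: sum_nonneg_eq_0_iff \<delta>_def)
qed

lemma bounded_vector_derivative_imp_uniformly_continuous:
  fixes f :: "real \<Rightarrow> 'a::real_normed_vector"
  assumes "convex S"
    and der: "\<And>x. x \<in> S \<Longrightarrow> (f has_vector_derivative f' x) (at x)"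
    and "\<And>x. x \<in> S \<Longrightarrow> norm (f' x) \<le> B"
  shows "uniformly_continuous_on S f"
proof -
  \<comment> \<open>The absolute value keeps the Lipschitz constant nonnegative even if
    \<open>S\<close> is empty.\<close>
  have "norm (f x - f y) \<le> \<bar>B\<bar> * norm (x - y)" if "x \<in> S" "y \<in> S" for x y
  proof (rule differentiable_bound[OF \<open>convex S\<close> _ _ that])
    fix x assume x: "x \<in> S"
    show "(f has_derivative (\<lambda>h. h *\<^sub>R f' x)) (at x within S)"
      using der[OF x] unfolding has_vector_derivative_def by (rule has_derivative_at_withinI)
    show "onorm (\<lambda>h. h *\<^sub>R f' x) \<le> \<bar>B\<bar>"
    proof (rule onorm_le)
      fix h
      have "norm (f' x) \<le> \<bar>B\<bar>" using assms(3)[OF x] by simp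
      then show "norm (h *\<^sub>R f' x) \<le> \<bar>B\<bar> * norm h"
        unfolding norm_scaleR real_norm_def mult.commute[of "\<bar>h\<bar>"] by (rule mult_right_mono) simp
    qed
  qed
  then have "\<bar>B\<bar>-lipschitz_on S f" by (intro lipschitz_onI) (auto simp: dist_norm)
  then show ?thesis by (rule lipschitz_on_uniformly_continuous)
qed

text \<open>This is part (i). Pairing \<open>w j\<close> with its velocity completes the product
  over all indices, so the difference of \<open>(cmod (w j t))\<^sup>2\<close> and
  \<open>of_int (a j) * u t\<close> has zero derivative on the interval.\<close>

lemma flow_conservation:
  fixes w :: "'m::finite \<Rightarrow> real \<Rightarrow> complex"
  assumes ode: "\<And>t j. t \<in> {-\<epsilon><..<\<epsilon>} \<Longrightarrow> (w j has_vector_derivative flow_field a (\<lambda>k. w k t) j) (at t)"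
    and u: "\<And>t. t \<in> {-\<epsilon><..<\<epsilon>} \<Longrightarrow> (u has_real_derivative 2 * Re (\<Prod>k\<in>UNIV. w k t)) (at t)"
    and init: "\<And>j. (cmod (w j 0))\<^sup>2 = of_int (a j) * u 0 + 1"
    and t: "t \<in> {-\<epsilon><..<\<epsilon>}"
  shows "(cmod (w j t))\<^sup>2 = of_int (a j) * u t + 1"
proof -
  let ?f = "\<lambda>t. (cmod (w j t))\<^sup>2 - of_int (a j) * u t"
  have "(?f has_real_derivative 0) (at s)" if s: "s \<in> {-\<epsilon><..<\<epsilon>}" for s
  proof -
    have "(\<Prod>k\<in>UNIV. w k s) = w j s * (\<Prod>k\<in>UNIV-{j}. w k s)"
      by (simp add: prod.remove)
    then have "2 * (w j s \<bullet> flow_field a (\<lambda>k. w k s) j) - of_int (a j) * (2 * Re (\<Prod>k\<in>UNIV. w k s)) = 0"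
      unfolding flow_field_def by (simp add: inner_complex_def algebra_simps del: cnj_prod)
    then show ?thesis
      using DERIV_diff[OF norm_square_has_real_derivative[OF ode[OF s]] DERIV_cmult[OF u[OF s]]]
      by metis
  qed
  then have "(?f has_field_derivative 0) (at s within {-\<epsilon><..<\<epsilon>})" if "s \<in> {-\<epsilon><..<\<epsilon>}" for s
    using that has_field_derivative_at_within by blast
  then obtain c where c: "\<And>s. s \<in> {-\<epsilon><..<\<epsilon>} \<Longrightarrow> ?f s = c"
    using has_field_derivative_zero_constant[of "{-\<epsilon><..<\<epsilon>}" ?f] by auto
  have "?f t = ?f 0" using c[OF t] c[of 0] t by auto
  then show ?thesis using init[of j] by simp
qed

section \<open>The parametrization\<close>

text \<open>The indices \<open>p\<close> and \<open>q\<close> have different weights, so the two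
  linear constraints on the phases can be solved for the phases at \<open>p\<close> and
  \<open>q\<close>. Their parameter slots then become free for the radius and the time. The sign
  \<open>\<sigma>\<close> stays open until the orientation is chosen.\<close>

locale sl_flow =
  fixes a :: "'m::finite \<Rightarrow> int" and \<epsilon> :: real and w :: "'m \<Rightarrow> real \<Rightarrow> complex"
    and u :: "real \<Rightarrow> real" and p q :: 'm and \<sigma> :: real
  assumes sum_a: "(\<Sum>j\<in>UNIV. a j) = 0"
    and apq: "a p \<noteq> a q"
    and eps: "\<epsilon> > 0"
    and w_nz: "t \<in> {-\<epsilon><..<\<epsilon>} \<Longrightarrow> w j t \<noteq> 0"
    and ode: "t \<in> {-\<epsilon><..<\<epsilon>} \<Longrightarrow> (w j has_vector_derivative flow_field a (\<lambda>k. w k t) j) (at t)"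
    and mod_w: "t \<in> {-\<epsilon><..<\<epsilon>} \<Longrightarrow> (cmod (w j t))\<^sup>2 = of_int (a j) * u t + 1"
    and sigma: "\<sigma> = 1 \<or> \<sigma> = -1"
begin

lemma pq: "p \<noteq> q" using apq by auto

lemma sum_split_pq: "(\<Sum>j\<in>UNIV. f j) = f p + f q + (\<Sum>j\<in>UNIV-{p,q}. f j)" for f :: "'m \<Rightarrow> 'b::comm_monoid_add"
proof -
  have "(\<Sum>j\<in>UNIV. f j) = f p + (\<Sum>j\<in>UNIV-{p}. f j)" by (simp add: sum.remove)
  also have "(\<Sum>j\<in>UNIV-{p}. f j) = f q + (\<Sum>j\<in>UNIV-{p}-{q}. f j)"
    using pq by (intro sum.remove) auto
  also have "UNIV-{p}-{q} = UNIV-{p,q}" by auto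
  finally show ?thesis by (simp add: add.assoc)
qed

text \<open>
  The rows \<open>B i\<close> with \<open>i \<noteq> p, q\<close> are an integral basis of the phases orthogonal to
  \<open>(1, \<dots>, 1)\<close> and \<open>a\<close>; integrality makes the parametrization periodic in the angles.
\<close>

definition B :: "'m \<Rightarrow> 'm \<Rightarrow> int" where
  "B i j = (if i = p \<or> i = q then 0 else
     (if j = i then a p - a q else 0) + (if j = p then a q - a i else 0) + (if j = q then a i - a p else 0))"

definition ph :: "real ^ 'm \<Rightarrow> 'm \<Rightarrow> real" where
  "ph x j = (\<Sum>i\<in>UNIV. x $ i * of_int (B i j))"

text \<open>A logarithm of the factor that multiplies \<open>w j\<close> in the parametrization. It
  is real linear in \<open>x\<close>, so translating the parameter multiplies this factor.\<close>

definition Lin :: "'m \<Rightarrow> real ^ 'm \<Rightarrow> complex" where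
  "Lin j x = of_real (\<sigma> * x $ p) + \<i> * of_real (ph x j)"

text \<open>
  The coordinate \<open>x $ p\<close> is the logarithm of the radius up to the sign \<open>\<sigma>\<close>, which fixes the
  orientation, \<open>x $ q\<close> is the time, and the other coordinates are the angles.
\<close>

definition \<Phi> :: "real ^ 'm \<Rightarrow> complex ^ 'm" where
  "\<Phi> x = (\<chi> j. exp (Lin j x) * w j (x $ q))"

definition D :: "(real ^ 'm) set" where
  "D = {x. x $ q \<in> {-\<epsilon><..<\<epsilon>}}"

definition W :: "real \<Rightarrow> complex" where
  "W t = (\<Prod>k\<in>UNIV. w k t)"

text \<open>
  The matrix of the tangent frame of \<open>\<Phi>\<close> is the real matrix \<open>C\<close> with its rows scaled by
  \<open>\<Phi> x $ j\<close> and its columns by \<open>Q x i\<close>.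
\<close>

definition C :: "real \<Rightarrow> real ^ 'm ^ 'm" where
  "C t = (\<chi> j i. if i = p then \<sigma> else if i = q then of_int (a j) / (cmod (w j t))\<^sup>2 else of_int (B i j))"

definition Q :: "real ^ 'm \<Rightarrow> 'm \<Rightarrow> complex" where
  "Q x i = (if i = p then 1 else if i = q then cnj (W (x $ q)) else \<i>)"

lemma B_pq [simp]: "B p j = 0" "B q j = 0"
  by (auto simp: B_def)

lemma B_other: "j \<noteq> p \<Longrightarrow> j \<noteq> q \<Longrightarrow> B i j = (if i = j then a p - a q else 0)"
  by (auto simp: B_def)

lemma sum_B: "(\<Sum>j\<in>UNIV. B i j) = 0"
  by (cases "i = p \<or> i = q") (auto simp: B_def sum.distrib)

lemma sum_a_B: "(\<Sum>j\<in>UNIV. a j * B i j) = 0"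
proof (cases "i = p \<or> i = q")
  case False
  then have "a j * B i j = (if j = i then a i * (a p - a q) else 0) +
      (if j = p then a p * (a q - a i) else 0) + (if j = q then a q * (a i - a p) else 0)" for j
    using pq by (auto simp: B_def)
  then have "(\<Sum>j\<in>UNIV. a j * B i j) = a i * (a p - a q) + a p * (a q - a i) + a q * (a i - a p)"
    by (simp add: sum.distrib)
  then show ?thesis by (simp add: algebra_simps)
qed auto

lemma sum_B_real: "(\<Sum>j\<in>UNIV. real_of_int (B i j)) = 0"
  using sum_B[of i] by (metis of_int_0 of_int_sum)

lemma sum_a_B_real: "(\<Sum>j\<in>UNIV. real_of_int (a j) * real_of_int (B i j)) = 0"
  using sum_a_B[of i] by (metis (mono_tags, lifting) of_int_0 of_int_mult of_int_sum sum.cong)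

lemma sum_a_real: "(\<Sum>j\<in>UNIV. real_of_int (a j)) = 0"
  using sum_a by (metis of_int_0 of_int_sum)

lemma sum_ph: "(\<Sum>j\<in>UNIV. ph x j) = 0"
  unfolding ph_def by (subst sum.swap) (simp add: sum_B_real flip: sum_distrib_left)

lemma sum_a_ph: "(\<Sum>j\<in>UNIV. of_int (a j) * ph x j) = 0"
proof -
  have "(\<Sum>j\<in>UNIV. of_int (a j) * ph x j) =
      (\<Sum>j\<in>UNIV. \<Sum>i\<in>UNIV. x $ i * (of_int (a j) * of_int (B i j)))"
    by (simp add: ph_def sum_distrib_left mult.left_commute)
  also have "\<dots> = (\<Sum>i\<in>UNIV. \<Sum>j\<in>UNIV. x $ i * (of_int (a j) * of_int (B i j)))"
    by (rule sum.swap)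
  also have "\<dots> = 0" by (simp add: sum_a_B_real flip: sum_distrib_left)
  finally show ?thesis .
qed

lemma ph_add: "ph (x + y) j = ph x j + ph y j"
  by (simp add: ph_def sum.distrib algebra_simps)

lemma ph_scale: "ph (r *\<^sub>R x) j = r * ph x j"
  by (simp add: ph_def sum_distrib_left mult.assoc)

lemma Lin_add: "Lin j (x + y) = Lin j x + Lin j y"
  by (simp add: Lin_def ph_add algebra_simps)

lemma ph_other: "j \<noteq> p \<Longrightarrow> j \<noteq> q \<Longrightarrow> ph x j = x $ j * of_int (a p - a q)"
  by (simp add: ph_def B_other if_distrib cong: if_cong)

text \<open>Away from \<open>p\<close> and \<open>q\<close> the phases agree by the choice of
  \<open>x\<close>. The two remaining differences satisfy a homogeneous system with determinant
  \<open>a q - a p\<close> up to sign, so they vanish.\<close>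

lemma phase_coordinates:
  assumes "(\<Sum>j\<in>UNIV. \<alpha> j) = 0" "(\<Sum>j\<in>UNIV. of_int (a j) * \<alpha> j) = 0"
    and x: "\<And>i. i \<noteq> p \<Longrightarrow> i \<noteq> q \<Longrightarrow> x $ i = \<alpha> i / of_int (a p - a q)"
  shows "ph x j = \<alpha> j"
proof -
  have d: "real_of_int (a p - a q) \<noteq> 0" using apq by simp
  have other: "ph x j = \<alpha> j" if "j \<noteq> p" "j \<noteq> q" for j
    using ph_other[OF that] x[OF that] d by simp
  define \<beta> where "\<beta> j = ph x j - \<alpha> j" for j
  have "(\<Sum>j\<in>UNIV. \<beta> j) = 0" "(\<Sum>j\<in>UNIV. of_int (a j) * \<beta> j) = 0"
    using assms sum_ph[of x] sum_a_ph[of x] by (simp_all add: \<beta>_def sum_subtractf right_diff_distrib)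
  then have e: "\<beta> p + \<beta> q = 0" "of_int (a p) * \<beta> p + of_int (a q) * \<beta> q = 0"
    unfolding sum_split_pq by (simp_all add: \<beta>_def other)
  then have "\<beta> q = - \<beta> p" by simp
  with e have "of_int (a p - a q) * \<beta> p = 0" by (simp add: algebra_simps)
  then have "\<beta> p = 0" "\<beta> q = 0" using d \<open>\<beta> q = - \<beta> p\<close> by (simp_all del: of_int_diff)
  then show ?thesis using other by (cases "j = p \<or> j = q") (auto simp: \<beta>_def)
qed

lemma image_\<Phi>:
  "\<Phi> ` D = {(\<chi> j. of_real r * exp (\<i> * of_real (\<alpha> j)) * w j t) | r t \<alpha>.
              r > 0 \<and> t \<in> {-\<epsilon><..<\<epsilon>} \<and> (\<Sum>j\<in>UNIV. \<alpha> j) = 0 \<and>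
              (\<Sum>j\<in>UNIV. of_int (a j) * \<alpha> j) = 0}" (is "_ = ?N")
proof
  show "\<Phi> ` D \<subseteq> ?N"
  proof safe
    fix x assume "x \<in> D"
    then show "\<exists>r t \<alpha>. \<Phi> x = (\<chi> j. of_real r * exp (\<i> * of_real (\<alpha> j)) * w j t) \<and>
        r > 0 \<and> t \<in> {-\<epsilon><..<\<epsilon>} \<and> (\<Sum>j\<in>UNIV. \<alpha> j) = 0 \<and> (\<Sum>j\<in>UNIV. of_int (a j) * \<alpha> j) = 0"
      by (intro exI[of _ "exp (\<sigma> * x $ p)"] exI[of _ "x $ q"] exI[of _ "ph x"])
         (simp add: \<Phi>_def D_def Lin_def exp_add sum_ph sum_a_ph flip: exp_of_real)
  qed
  show "?N \<subseteq> \<Phi> ` D"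
  proof safe
    fix r t :: real and \<alpha> :: "'m \<Rightarrow> real"
    assume r: "r > 0" and t: "t \<in> {-\<epsilon><..<\<epsilon>}"
      and \<alpha>: "(\<Sum>j\<in>UNIV. \<alpha> j) = 0" "(\<Sum>j\<in>UNIV. of_int (a j) * \<alpha> j) = 0"
    \<comment> \<open>Since \<open>\<sigma>\<close> is its own inverse,
      \<open>\<sigma> * ln r\<close> produces the radius \<open>r\<close>. The division undoes the
      diagonal entry \<open>a p - a q\<close> of the angular rows.\<close>
    define x :: "real ^ 'm" where
      "x = (\<chi> i. if i = p then \<sigma> * ln r else if i = q then t else \<alpha> i / of_int (a p - a q))"
    have "ph x j = \<alpha> j" for j
      using \<alpha> by (rule phase_coordinates) (simp add: x_def)
    moreover have "\<sigma> * x $ p = ln r" using sigma by (auto simp: x_def)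
    moreover have "x $ q = t" using pq by (simp add: x_def)
    ultimately have "x \<in> D" "\<Phi> x = (\<chi> j. of_real r * exp (\<i> * of_real (\<alpha> j)) * w j t)"
      using t r by (simp_all add: D_def \<Phi>_def Lin_def exp_add exp_of_real)
    then show "(\<chi> j. of_real r * exp (\<i> * of_real (\<alpha> j)) * w j t) \<in> \<Phi> ` D"
      by force
  qed
qed

lemma open_D: "open D"
proof -
  have "D = {x. -\<epsilon> < x $ q} \<inter> {x. x $ q < \<epsilon>}" by (auto simp: D_def)
  then show ?thesis
    by (simp add: open_Int open_Collect_less continuous_on_component continuous_intros)
qed

text \<open>The weights sum to zero, so the curve stays on a fixed sphere. The radial parameter can
  therefore be read off from the norm of the image point.\<close>

lemma sum_mod_w: "t \<in> {-\<epsilon><..<\<epsilon>} \<Longrightarrow> (\<Sum>j\<in>UNIV. (cmod (w j t))\<^sup>2) = CARD('m)"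
  using sum_a_real by (simp add: mod_w sum.distrib flip: sum_distrib_right)

text \<open>The logarithmic velocities are real multiples of one complex factor
  \<open>cnj (W t)\<close> common to all coordinates. Moving this factor into \<open>Q\<close> is
  what leaves \<open>C\<close> real.\<close>

lemma velocity_factor:
  assumes "t \<in> {-\<epsilon><..<\<epsilon>}"
  shows "flow_field a (\<lambda>k. w k t) j = w j t * cnj (W t) * (of_int (a j) / of_real ((cmod (w j t))\<^sup>2))"
proof -
  have "W t = w j t * (\<Prod>k\<in>UNIV-{j}. w k t)" by (simp add: W_def prod.remove)
  then show ?thesis
    using w_nz[OF assms, of j] unfolding complex_norm_square by (simp add: flow_field_def)
qed

section \<open>Differentiation of the parametrization\<close>

lemma Lin_has_derivative: "(Lin j has_derivative Lin j) F"
proof -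
  have "bounded_linear (Lin j)"
    unfolding linear_conv_bounded_linear[symmetric]
  proof
    show "Lin j (r *\<^sub>R x) = r *\<^sub>R Lin j x" for r x
      by (simp add: complex_eq_iff Lin_def ph_scale)
  qed (rule Lin_add)
  then show ?thesis by (rule bounded_linear_imp_has_derivative)
qed

lemma exp_Lin_has_derivative:
  "((\<lambda>x. exp (Lin j x)) has_derivative (\<lambda>h. Lin j h * exp (Lin j x))) (at x)"
  by (rule has_derivative_eq_rhs[OF has_derivative_compose[OF Lin_has_derivative
        DERIV_exp[unfolded has_field_derivative_def]]])
     (auto simp: mult.commute)

lemma w_has_derivative:
  assumes "x \<in> D"
  shows "((\<lambda>x. w j (x $ q)) has_derivative
    (\<lambda>h. of_real (h $ q) * flow_field a (\<lambda>k. w k (x $ q)) j)) (at x)"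
proof -
  have "((\<lambda>x. x $ q) has_derivative (\<lambda>h. h $ q)) (at x)"
    by (rule bounded_linear_imp_has_derivative) (rule bounded_linear_vec_nth)
  from has_derivative_compose[OF this ode[unfolded has_vector_derivative_def]]
  show ?thesis using assms by (auto simp: D_def scaleR_conv_of_real)
qed

lemma column_combination:
  "(\<Sum>i\<in>UNIV. of_real (h $ i) * Q x i * of_real (C (x $ q) $ j $ i)) =
    Lin j h + of_real (h $ q) * cnj (W (x $ q)) * (of_int (a j) / of_real ((cmod (w j (x $ q)))\<^sup>2))"
proof -
  have "of_real (ph h j) = (\<Sum>i\<in>UNIV-{p,q}. of_real (h $ i) * of_int (B i j) :: complex)"
    unfolding ph_def of_real_sum sum_split_pq by simp
  moreover have "(\<Sum>i\<in>UNIV-{p,q}. of_real (h $ i) * Q x i * of_real (C (x $ q) $ j $ i)) =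
      \<i> * (\<Sum>i\<in>UNIV-{p,q}. of_real (h $ i) * of_int (B i j))"
    unfolding sum_distrib_left by (intro sum.cong) (auto simp: Q_def C_def)
  ultimately show ?thesis
    using pq unfolding sum_split_pq by (simp add: Q_def C_def Lin_def)
qed

lemma \<Phi>_has_derivative:
  assumes "x \<in> D"
  shows "(\<Phi> has_derivative
    (\<lambda>h. \<chi> j. \<Phi> x $ j * (\<Sum>i\<in>UNIV. of_real (h $ i) * Q x i * of_real (C (x $ q) $ j $ i)))) (at x)"
proof (rule has_derivative_vec)
  fix j
  have t: "x $ q \<in> {-\<epsilon><..<\<epsilon>}" using assms by (simp add: D_def)
  have "((\<lambda>x. exp (Lin j x) * w j (x $ q)) has_derivative
      (\<lambda>h. exp (Lin j x) * (of_real (h $ q) * flow_field a (\<lambda>k. w k (x $ q)) j) +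
        Lin j h * exp (Lin j x) * w j (x $ q))) (at x)"
    by (intro has_derivative_mult exp_Lin_has_derivative w_has_derivative assms)
  then show "((\<lambda>x. \<Phi> x $ j) has_derivative (\<lambda>h. (\<chi> j. \<Phi> x $ j *
      (\<Sum>i\<in>UNIV. of_real (h $ i) * Q x i * of_real (C (x $ q) $ j $ i))) $ j)) (at x)"
    unfolding column_combination velocity_factor[OF t]
    by (simp add: \<Phi>_def algebra_simps)
qed

lemma frame_\<Phi>:
  assumes "x \<in> D"
  shows "frame \<Phi> x i $ j = \<Phi> x $ j * Q x i * of_real (C (x $ q) $ j $ i)"
proof -
  have "of_real (axis i 1 $ k) * Q x k * of_real (C (x $ q) $ j $ k) =
      (if k = i then Q x i * of_real (C (x $ q) $ j $ i) else 0)" for k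
    by (simp add: axis_def)
  then show ?thesis
    unfolding frame_def frechet_derivative_at[OF \<Phi>_has_derivative[OF assms], symmetric]
    by (simp add: mult.assoc)
qed

lemma smooth_\<Phi>:
  assumes "open V" "V \<subseteq> D"
  shows "smooth_on V \<Phi>"
proof -
  \<comment> \<open>Conjugates are included because (A) expresses the derivative of each
    \<open>w j\<close> through conjugates of the others, and conversely; the generated algebra is
    then closed under differentiation.\<close>
  define G where "G = range (\<lambda>j x. w j (x $ q)) \<union> range (\<lambda>j x. cnj (w j (x $ q))) \<union> range (\<lambda>j x. exp (Lin j x))"
  have gen: "(\<lambda>x. w j (x $ q)) \<in> gen_algebra G" "(\<lambda>x. cnj (w j (x $ q))) \<in> gen_algebra G"
    "(\<lambda>x. exp (Lin j x)) \<in> gen_algebra G" for j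
    by (auto simp: G_def intro!: gen_algebra.gen)
  show ?thesis
  proof (rule smooth_on_gen_algebra[OF \<open>open V\<close>])
    show "(\<lambda>x. \<Phi> x $ j) \<in> gen_algebra G" for j
      unfolding \<Phi>_def vec_lambda_beta by (intro gen_algebra.mult gen)
  next
    fix g assume "g \<in> G"
    then consider j where "g = (\<lambda>x. w j (x $ q))" | j where "g = (\<lambda>x. cnj (w j (x $ q)))"
      | j where "g = (\<lambda>x. exp (Lin j x))"
      by (auto simp: G_def)
    then show "\<exists>g'. (\<forall>v. g' v \<in> gen_algebra G) \<and> (\<forall>x\<in>V. (g has_derivative (\<lambda>v. g' v x)) (at x))"
    proof cases
      case 1
      have "(\<lambda>x. of_real (v $ q) * (of_int (a j) * (\<Prod>k\<in>UNIV-{j}. cnj (w k (x $ q))))) \<in> gen_algebra G" for v :: "real ^ 'm"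
        by (intro gen_algebra.mult gen_algebra.const gen_algebra_prod gen)
      then show ?thesis
        using w_has_derivative[of _ j] assms(2) unfolding 1
        by (intro exI[of _ "\<lambda>v x. of_real (v $ q) * (of_int (a j) * (\<Prod>k\<in>UNIV-{j}. cnj (w k (x $ q))))"])
           (auto simp: flow_field_def)
    next
      case 2
      have "(\<lambda>x. of_real (v $ q) * (of_int (a j) * (\<Prod>k\<in>UNIV-{j}. w k (x $ q)))) \<in> gen_algebra G" for v :: "real ^ 'm"
        by (intro gen_algebra.mult gen_algebra.const gen_algebra_prod gen)
      then show ?thesis
        using bounded_linear.has_derivative[OF bounded_linear_cnj w_has_derivative[of _ j]] assms(2) unfolding 2
        by (intro exI[of _ "\<lambda>v x. of_real (v $ q) * (of_int (a j) * (\<Prod>k\<in>UNIV-{j}. w k (x $ q)))"])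
           (auto simp: flow_field_def)
    next
      case 3
      show ?thesis
        using exp_Lin_has_derivative[of j] unfolding 3
        by (intro exI[of _ "\<lambda>v x. Lin j v * exp (Lin j x)"])
           (auto intro!: gen_algebra.mult gen_algebra.const gen)
    qed
  qed
qed

section \<open>The tangent frame\<close>

lemma w_pos: "t \<in> {-\<epsilon><..<\<epsilon>} \<Longrightarrow> (cmod (w j t))\<^sup>2 > 0"
  using w_nz by simp


text \<open>
  With the weights \<open>|w_k|^2 = a_k u + 1\<close>, columns \<open>p\<close> and \<open>q\<close> of \<open>C\<close> are orthogonal to all other
  columns. This gives both the Lagrangian condition and the nonvanishing of the determinant.
\<close>

lemma C_orthogonal:
  assumes t: "t \<in> {-\<epsilon><..<\<epsilon>}" and "i \<noteq> j" "i = p \<or> i = q"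
  shows "(\<Sum>k\<in>UNIV. (cmod (w k t))\<^sup>2 * C t $ k $ i * C t $ k $ j) = 0"
proof -
  have nz: "cmod (w k t) \<noteq> 0" for k using w_nz[OF t] by simp
  have "(\<Sum>k\<in>UNIV. (cmod (w k t))\<^sup>2 * real_of_int (B j k)) =
      u t * (\<Sum>k\<in>UNIV. real_of_int (a k) * real_of_int (B j k)) + (\<Sum>k\<in>UNIV. real_of_int (B j k))"
    by (simp add: mod_w[OF t] algebra_simps sum.distrib sum_distrib_left)
  then have 1: "(\<Sum>k\<in>UNIV. (cmod (w k t))\<^sup>2 * real_of_int (B j k)) = 0"
    by (simp add: sum_a_B_real sum_B_real)
  consider "i = p" "j = q" | "i = q" "j = p" | "i = p" "j \<noteq> p" "j \<noteq> q" | "i = q" "j \<noteq> p" "j \<noteq> q"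
    using assms by blast
  then show ?thesis
  proof cases
    case 1
    then show ?thesis using pq nz sum_a_real by (simp add: C_def flip: sum_distrib_left)
  next
    case 2
    then show ?thesis using pq nz sum_a_real by (simp add: C_def flip: sum_distrib_right)
  next
    case 3
    then have "(\<Sum>k\<in>UNIV. (cmod (w k t))\<^sup>2 * C t $ k $ i * C t $ k $ j) =
        \<sigma> * (\<Sum>k\<in>UNIV. (cmod (w k t))\<^sup>2 * real_of_int (B j k))"
      unfolding sum_distrib_left by (simp add: C_def mult.assoc mult.left_commute)
    with 1 show ?thesis by simp
  next
    case 4
    then show ?thesis using pq nz sum_a_B_real by (simp add: C_def)
  qed
qed

lemma C_column_norm_pos:
  assumes t: "t \<in> {-\<epsilon><..<\<epsilon>}" and "i = p \<or> i = q"
  shows "(\<Sum>k\<in>UNIV. (cmod (w k t))\<^sup>2 * C t $ k $ i * C t $ k $ i) > 0"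
proof -
  have "a p \<noteq> 0 \<or> a q \<noteq> 0" using apq by auto
  then obtain k where k: "C t $ k $ i \<noteq> 0"
    using assms(2) pq sigma w_nz[OF t] unfolding C_def by fastforce
  show ?thesis
    using w_pos[OF t] k by (intro sum_pos2[of _ k]) (auto simp: mult.assoc zero_less_mult_iff)
qed

text \<open>Pairing a kernel vector with columns \<open>p\<close> and \<open>q\<close> in the
  weighted inner product kills its entries there, by orthogonality. Each other row then has the
  single entry \<open>a p - a q\<close> left, so the remaining entries vanish too.\<close>

lemma det_C_nz:
  assumes t: "t \<in> {-\<epsilon><..<\<epsilon>}"
  shows "det (C t) \<noteq> 0"
proof -
  have "y = 0" if y: "C t *v y = 0" for y
  proof -
    have comb: "(\<Sum>i\<in>UNIV. C t $ k $ i * y $ i) = 0" for k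
      using y by (simp add: matrix_vector_mult_def vec_eq_iff)
    have pq0: "y $ j = 0" if j: "j = p \<or> j = q" for j
    proof -
      define N where "N i = (\<Sum>k\<in>UNIV. (cmod (w k t))\<^sup>2 * C t $ k $ j * C t $ k $ i)" for i
      have "0 = (\<Sum>k\<in>UNIV. (cmod (w k t))\<^sup>2 * C t $ k $ j * (\<Sum>i\<in>UNIV. C t $ k $ i * y $ i))"
        using comb by simp
      also have "\<dots> = (\<Sum>i\<in>UNIV. N i * y $ i)"
        unfolding N_def sum_distrib_left sum_distrib_right
        by (subst sum.swap) (simp add: mult.assoc)
      also have "\<dots> = N j * y $ j"
        using C_orthogonal[OF t _ j] by (subst sum.remove[of _ j]) (auto simp: N_def intro!: sum.neutral)
      finally show ?thesis using C_column_norm_pos[OF t j] by (simp add: N_def)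
    qed
    have "y $ k = 0" if "k \<noteq> p" "k \<noteq> q" for k
    proof -
      have "C t $ k $ i * y $ i = (if i = k then of_int (a p - a q) * y $ k else 0)" for i
        using that pq0 by (auto simp: C_def B_other)
      then have "of_int (a p - a q) * y $ k = 0" using comb[of k] by simp
      then show ?thesis using apq by auto
    qed
    with pq0 show ?thesis by (auto simp: vec_eq_iff)
  qed
  then show ?thesis
    using matrix_left_invertible_ker[of "C t"] invertible_left_inverse[of "C t"] invertible_det_nz[of "C t"]
    by blast
qed

lemma w_continuous: "continuous_on {-\<epsilon><..<\<epsilon>} (w j)"
  using ode has_vector_derivative_continuous continuous_at_imp_continuous_on by blast

text \<open>A continuous function without zeros on an interval keeps its sign. Hence one choice of
  \<open>\<sigma>\<close> orients the parametrization for all times.\<close>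

lemma det_C_sign: "(\<forall>t\<in>{-\<epsilon><..<\<epsilon>}. det (C t) > 0) \<or> (\<forall>t\<in>{-\<epsilon><..<\<epsilon>}. det (C t) < 0)"
proof (rule ccontr)
  assume "\<not> ?thesis"
  then obtain s t where st: "s \<in> {-\<epsilon><..<\<epsilon>}" "t \<in> {-\<epsilon><..<\<epsilon>}" "det (C s) \<le> 0" "0 \<le> det (C t)"
    by (auto simp: not_less)
  have "continuous_on {-\<epsilon><..<\<epsilon>} (\<lambda>t. C t $ j $ i)" for i j
    using w_continuous[of j] w_nz unfolding C_def
    by (cases "i = p"; cases "i = q") (auto intro!: continuous_intros)
  then have "continuous_on {-\<epsilon><..<\<epsilon>} (\<lambda>t. det (C t))"
    unfolding det_def by (intro continuous_on_sum continuous_on_mult continuous_on_prod continuous_on_const)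
  then have "connected ((\<lambda>t. det (C t)) ` {-\<epsilon><..<\<epsilon>})"
    by (intro connected_continuous_image) auto
  then have "0 \<in> (\<lambda>t. det (C t)) ` {-\<epsilon><..<\<epsilon>}"
    using st connectedD_interval by blast
  then show False using det_C_nz by force
qed

lemma cmod_\<Phi>: "cmod (\<Phi> x $ j) = exp (\<sigma> * x $ p) * cmod (w j (x $ q))"
  by (simp add: \<Phi>_def Lin_def norm_mult)

lemma prod_\<Phi>: "(\<Prod>j\<in>UNIV. \<Phi> x $ j) = of_real (exp (\<sigma> * x $ p) ^ CARD('m)) * W (x $ q)"
proof -
  have "(\<Sum>j\<in>UNIV. Lin j x) = of_nat CARD('m) * of_real (\<sigma> * x $ p) + \<i> * of_real (\<Sum>j\<in>UNIV. ph x j)"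
    by (simp add: Lin_def sum.distrib flip: sum_distrib_left)
  then have "(\<Prod>j\<in>UNIV. exp (Lin j x)) = exp (of_nat CARD('m) * of_real (\<sigma> * x $ p))"
    by (simp add: sum_ph flip: exp_sum)
  also have "\<dots> = of_real (exp (\<sigma> * x $ p) ^ CARD('m))"
    by (simp only: exp_of_nat_mult exp_of_real of_real_power)
  finally show ?thesis by (simp add: \<Phi>_def W_def prod.distrib)
qed

text \<open>Each of the \<open>CARD('m) - 2\<close> angular columns contributes a factor
  \<open>\<i>\<close>. This is the origin of the phase.\<close>

lemma prod_Q: "(\<Prod>i\<in>UNIV. Q x i) = cnj (W (x $ q)) * \<i> ^ (CARD('m) - 2)"
proof -
  have "(\<Prod>i\<in>UNIV. Q x i) = Q x p * (\<Prod>i\<in>UNIV-{p}. Q x i)" by (simp add: prod.remove)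
  also have "(\<Prod>i\<in>UNIV-{p}. Q x i) = Q x q * (\<Prod>i\<in>UNIV-{p}-{q}. Q x i)"
    using pq by (intro prod.remove) auto
  also have "(\<Prod>i\<in>UNIV-{p}-{q}. Q x i) = (\<Prod>i\<in>UNIV-{p}-{q}. \<i>)"
    by (intro prod.cong) (auto simp: Q_def)
  also have "\<dots> = \<i> ^ (CARD('m) - 2)"
    using pq by (simp add: card_Diff_singleton numeral_2_eq_2)
  finally show ?thesis using pq by (simp add: Q_def)
qed

text \<open>The real density of \<open>\<Omega>\<close> on the frame once the phase is split off.
  The squared modulus arises from \<open>W\<close> in the product of the coordinates and its
  conjugate in the time column, so the sign is that of \<open>det (C (x $ q))\<close>.\<close>

definition vol :: "real ^ 'm \<Rightarrow> real" where
  "vol x = exp (\<sigma> * x $ p) ^ CARD('m) * (cmod (W (x $ q)))\<^sup>2 * det (C (x $ q))"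

lemma holo_vol_\<Phi>:
  assumes "x \<in> D"
  shows "holo_vol (frame \<Phi> x) = of_real (vol x) * \<i> ^ (CARD('m) - 2)"
proof -
  have "holo_vol (frame \<Phi> x) =
      det (\<chi> k j. \<Phi> x $ k * Q x j * (\<chi> k j. of_real (C (x $ q) $ k $ j)) $ k $ j)"
    by (simp add: holo_vol_def frame_\<Phi>[OF assms])
  also have "\<dots> = (\<Prod>j\<in>UNIV. \<Phi> x $ j) * (\<Prod>i\<in>UNIV. Q x i) * of_real (det (C (x $ q)))"
    by (subst det_scale_rows_columns) (simp add: det_of_real)
  also have "\<dots> = of_real (vol x) * \<i> ^ (CARD('m) - 2)"
    unfolding prod_\<Phi> prod_Q vol_def of_real_mult complex_norm_square by (simp add: mult_ac)
  finally show ?thesis .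
qed

lemma W_nz: "t \<in> {-\<epsilon><..<\<epsilon>} \<Longrightarrow> W t \<noteq> 0"
  using w_nz by (simp add: W_def)

text \<open>The Hermitian product of two columns is \<open>cnj (Q x i) * Q x j\<close> times a real
  number. The first factor is real on the diagonal and between angular columns; in every other case
  the real number is zero by \<open>C_orthogonal\<close>.\<close>

lemma frame_Lagrangian:
  assumes "x \<in> D"
  shows "(\<Sum>k\<in>UNIV. cnj (frame \<Phi> x i $ k) * frame \<Phi> x j $ k) \<in> \<real>"
proof -
  have t: "x $ q \<in> {-\<epsilon><..<\<epsilon>}" using assms by (simp add: D_def)
  define H where "H = (\<Sum>k\<in>UNIV. (cmod (w k (x $ q)))\<^sup>2 * C (x $ q) $ k $ i * C (x $ q) $ k $ j)"
  have "cnj (frame \<Phi> x i $ k) * frame \<Phi> x j $ k = cnj (Q x i) * Q x j * of_real ((exp (\<sigma> * x $ p))\<^sup>2 *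
      ((cmod (w k (x $ q)))\<^sup>2 * C (x $ q) $ k $ i * C (x $ q) $ k $ j))" for k
  proof -
    have "cnj (frame \<Phi> x i $ k) * frame \<Phi> x j $ k = cnj (Q x i) * Q x j *
        (\<Phi> x $ k * cnj (\<Phi> x $ k)) * of_real (C (x $ q) $ k $ i * C (x $ q) $ k $ j)"
      unfolding frame_\<Phi>[OF assms] by (simp add: mult_ac)
    then show ?thesis
      unfolding complex_norm_square[symmetric] cmod_\<Phi> power_mult_distrib by (simp add: mult_ac)
  qed
  then have eq: "(\<Sum>k\<in>UNIV. cnj (frame \<Phi> x i $ k) * frame \<Phi> x j $ k) =
      cnj (Q x i) * Q x j * of_real ((exp (\<sigma> * x $ p))\<^sup>2 * H)"
    unfolding H_def sum_distrib_left of_real_sum by simp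
  consider "i = j" | "i \<noteq> j" "i = p \<or> i = q" | "i \<noteq> j" "j = p \<or> j = q"
    | "i \<noteq> p" "i \<noteq> q" "j \<noteq> p" "j \<noteq> q" by blast
  then show ?thesis
  proof cases
    case 1
    have "cnj (Q x j) * Q x j \<in> \<real>"
      by (metis Reals_of_real complex_norm_square mult.commute)
    then show ?thesis unfolding eq[unfolded 1] 1 by (rule Reals_mult) (rule Reals_of_real)
  next
    case 2
    then have "H = 0" using C_orthogonal[OF t] by (simp add: H_def)
    then show ?thesis unfolding eq by simp
  next
    case 3
    then have "H = 0" using C_orthogonal[OF t, of j i] by (simp add: H_def mult_ac)
    then show ?thesis unfolding eq by simp
  next
    case 4
    then have "cnj (Q x i) * Q x j = 1" by (simp add: Q_def)
    then show ?thesis unfolding eq by simp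
  qed
qed

text \<open>A real vector killed by the derivative is also killed by the complex frame matrix, whose
  determinant is the nonzero value of \<open>\<Omega>\<close>.\<close>

lemma inj_derivative_\<Phi>:
  assumes "x \<in> D"
  shows "inj (frechet_derivative \<Phi> (at x))"
proof -
  have t: "x $ q \<in> {-\<epsilon><..<\<epsilon>}" using assms by (simp add: D_def)
  let ?A = "\<chi> k j. frame \<Phi> x j $ k"
  have "det ?A \<noteq> 0"
    using holo_vol_\<Phi>[OF assms] det_C_nz[OF t] W_nz[OF t] by (simp add: holo_vol_def vol_def)
  then have ker: "?A *v y = 0 \<Longrightarrow> y = 0" for y
    using matrix_left_invertible_ker[of ?A] invertible_left_inverse[of ?A] invertible_det_nz[of ?A]
    by blast
  have lin: "linear (frechet_derivative \<Phi> (at x))"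
    unfolding frechet_derivative_at[OF \<Phi>_has_derivative[OF assms], symmetric]
    using \<Phi>_has_derivative[OF assms] by (rule has_derivative_linear)
  have "h = 0" if "frechet_derivative \<Phi> (at x) h = 0" for h
  proof -
    have "?A *v (\<chi> i. of_real (h $ i)) = frechet_derivative \<Phi> (at x) h"
      unfolding frechet_derivative_at[OF \<Phi>_has_derivative[OF assms], symmetric] vec_eq_iff
        matrix_vector_mult_def vec_lambda_beta frame_\<Phi>[OF assms] sum_distrib_left
      by (intro allI sum.cong refl) (simp only: mult_ac)
    then have "?A *v (\<chi> i. of_real (h $ i)) = 0" using that by (rule trans)
    from ker[OF this] show ?thesis by (simp add: vec_eq_iff)
  qed
  then show ?thesis using lin linear_injective_0 by blast
qed

lemma norm_\<Phi>:
  assumes "x \<in> D"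
  shows "norm (\<Phi> x) = exp (\<sigma> * x $ p) * sqrt CARD('m)"
proof -
  have "x $ q \<in> {-\<epsilon><..<\<epsilon>}" using assms by (simp add: D_def)
  then have "(\<Sum>j\<in>UNIV. (cmod (\<Phi> x $ j))\<^sup>2) = (exp (\<sigma> * x $ p))\<^sup>2 * CARD('m)"
    unfolding cmod_\<Phi> power_mult_distrib by (simp add: sum_mod_w flip: sum_distrib_left)
  then show ?thesis by (simp add: norm_vec_def L2_set_def real_sqrt_mult)
qed

text \<open>The norm of the image point gives the radius, the product of its coordinates then gives
  \<open>W\<close>, and their moduli give those of \<open>w\<close>. The frame depends on nothing
  else, so it cannot differ between two parameters over one point.\<close>

lemma frame_determined_by_point:
  assumes "x \<in> D" "y \<in> D" "\<Phi> x = \<Phi> y"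
  shows "frame \<Phi> x i = frame \<Phi> y i"
proof -
  have e: "exp (\<sigma> * x $ p) = exp (\<sigma> * y $ p)"
    using norm_\<Phi>[OF assms(1)] norm_\<Phi>[OF assms(2)] assms(3) by auto
  have "W (x $ q) = W (y $ q)"
    using prod_\<Phi>[of x] prod_\<Phi>[of y] assms(3) e by simp
  moreover have "cmod (w j (x $ q)) = cmod (w j (y $ q))" for j
    using cmod_\<Phi>[of x j] cmod_\<Phi>[of y j] assms(3) e by simp
  ultimately show ?thesis
    using assms by (simp add: vec_eq_iff frame_\<Phi> Q_def C_def)
qed

section \<open>Embeddedness\<close>

lemma w_bounded:
  assumes "t \<in> {-\<epsilon><..<\<epsilon>}"
  shows "cmod (w j t) \<le> sqrt CARD('m)"
proof -
  have "(cmod (w j t))\<^sup>2 \<le> CARD('m)"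
    unfolding sum_mod_w[OF assms, symmetric] by (rule member_le_sum) auto
  then show ?thesis by (rule real_le_rsqrt)
qed

text \<open>Bounded velocity makes the curve uniformly continuous, hence extendable to the closed
  interval. This is needed because a limit of parameters may have boundary time.\<close>

lemma w_extends:
  obtains wb where "\<And>j. continuous_on {-\<epsilon>..\<epsilon>} (wb j)"
    "\<And>j t. t \<in> {-\<epsilon><..<\<epsilon>} \<Longrightarrow> wb j t = w j t"
proof -
  have "uniformly_continuous_on {-\<epsilon><..<\<epsilon>} (w j)" for j
  proof (rule bounded_vector_derivative_imp_uniformly_continuous[OF _ ode])
    fix t assume t: "t \<in> {-\<epsilon><..<\<epsilon>}"
    have "(\<Prod>k\<in>UNIV-{j}. cmod (w k t)) \<le> (\<Prod>k\<in>UNIV-{j}. sqrt CARD('m))"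
      by (intro prod_mono conjI w_bounded t norm_ge_zero)
    then show "cmod (flow_field a (\<lambda>k. w k t) j) \<le> \<bar>of_int (a j)\<bar> * (\<Prod>k\<in>UNIV-{j}. sqrt CARD('m))"
      unfolding flow_field_def norm_mult complex_mod_cnj prod_norm[symmetric]
      by (intro mult_mono) (auto intro: prod_nonneg)
  qed auto
  then have "\<exists>g. continuous_on {-\<epsilon>..\<epsilon>} g \<and> (\<forall>t\<in>{-\<epsilon><..<\<epsilon>}. g t = w j t)" for j
    using uniformly_continuous_on_extension_on_closure[of "{-\<epsilon><..<\<epsilon>}" "w j"] eps
      uniformly_continuous_imp_continuous
    by (metis closure_greaterThanLessThan less_trans neg_less_0_iff_less)
  then show ?thesis using that by metis
qed

text \<open>As the phases sum to zero, those other than \<open>j\<close> multiply to the inverse of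
  the \<open>j\<close>-th one, and the conjugation in (A) inverts it back.\<close>

lemma rotated_solution:
  assumes "(\<Sum>j\<in>UNIV. \<gamma> j) = 0" "t \<in> {-\<epsilon><..<\<epsilon>}"
  shows "((\<lambda>t. exp (\<i> * of_real (\<gamma> j)) * w j t) has_vector_derivative
    flow_field a (\<lambda>k. exp (\<i> * of_real (\<gamma> k)) * w k t) j) (at t)"
proof -
  have "(\<Sum>k\<in>UNIV-{j}. \<gamma> k) = - \<gamma> j"
    using assms(1) by (simp add: sum.remove[of UNIV j])
  then have "(\<Prod>k\<in>UNIV-{j}. exp (\<i> * of_real (\<gamma> k))) = exp (\<i> * of_real (- \<gamma> j))"
    by (simp flip: exp_sum sum_distrib_left of_real_sum)
  then have "cnj (\<Prod>k\<in>UNIV-{j}. exp (\<i> * of_real (\<gamma> k))) = exp (\<i> * of_real (\<gamma> j))"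
    by (simp del: cnj_prod add: exp_cnj)
  then have "flow_field a (\<lambda>k. exp (\<i> * of_real (\<gamma> k)) * w k t) j =
      exp (\<i> * of_real (\<gamma> j)) * flow_field a (\<lambda>k. w k t) j"
    unfolding flow_field_def prod.distrib complex_cnj_mult by (simp only: mult_ac)
  then show ?thesis
    using has_vector_derivative_mult_right[OF ode[OF assms(2)]] by simp
qed

text \<open>If the curve at one time is a rotation of the curve at another, uniqueness propagates
  this relation to all common time shifts. The time \<open>t1\<close> may be an end of the interval,
  hence the extension \<open>wb\<close>.\<close>

lemma flow_recurrence:
  assumes wb: "\<And>j. continuous_on {-\<epsilon>..\<epsilon>} (wb j)" "\<And>j t. t \<in> {-\<epsilon><..<\<epsilon>} \<Longrightarrow> wb j t = w j t"
    and \<gamma>: "(\<Sum>j\<in>UNIV. \<gamma> j) = 0"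
    and t: "t1 \<in> {-\<epsilon>..\<epsilon>}" "t0 \<in> {-\<epsilon><..<\<epsilon>}"
    and s: "t1 + s \<in> {-\<epsilon>..\<epsilon>}" "t0 + s \<in> {-\<epsilon><..<\<epsilon>}"
    and init: "\<And>j. wb j t1 = exp (\<i> * of_real (\<gamma> j)) * w j t0"
  shows "wb j (t1 + s) = exp (\<i> * of_real (\<gamma> j)) * w j (t0 + s)"
proof -
  have seg: "t1 + x \<in> {-\<epsilon>..\<epsilon>}" "t0 + x \<in> {-\<epsilon><..<\<epsilon>}" if "x \<in> closed_segment 0 s" for x
    using that t s by (auto simp: closed_segment_eq_real_ivl split: if_splits)
  have oseg: "t1 + x \<in> {-\<epsilon><..<\<epsilon>}" "t0 + x \<in> {-\<epsilon><..<\<epsilon>}" if "x \<in> open_segment 0 s" for x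
    using that t s by (auto simp: open_segment_eq_real_ivl split: if_splits)
  have shift: "((\<lambda>x. f (c + x)) has_vector_derivative f') (at x)"
    if "(f has_vector_derivative f') (at (c + x))" for f :: "real \<Rightarrow> complex" and f' c x
  proof -
    have "((\<lambda>x. c + x) has_vector_derivative 1) (at x)"
      by (auto intro!: derivative_eq_intros)
    from vector_diff_chain_at[OF this that] show ?thesis by (simp add: o_def)
  qed
  show ?thesis
  proof (rule flow_unique[where s = s and a = a and M = "sqrt CARD('m)"
        and f = "\<lambda>j x. wb j (t1 + x)" and g = "\<lambda>j x. exp (\<i> * of_real (\<gamma> j)) * w j (t0 + x)"])
    fix j
    show "continuous_on (closed_segment 0 s) (\<lambda>x. wb j (t1 + x))"
      using seg by (intro continuous_on_compose2[OF wb(1)] continuous_intros) auto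
    show "continuous_on (closed_segment 0 s) (\<lambda>x. exp (\<i> * of_real (\<gamma> j)) * w j (t0 + x))"
      using seg by (intro continuous_intros continuous_on_compose2[OF w_continuous]) auto
    show "wb j (t1 + 0) = exp (\<i> * of_real (\<gamma> j)) * w j (t0 + 0)" using init by simp
  next
    fix x j assume x: "x \<in> open_segment 0 s"
    note ox = oseg[OF x]
    have "(wb j has_vector_derivative flow_field a (\<lambda>k. wb k (t1 + x)) j) (at (t1 + x))"
      unfolding wb(2)[OF ox(1)]
      using has_vector_derivative_transform_within_open[OF ode[OF ox(1)] open_greaterThanLessThan ox(1)]
      by (simp add: wb(2))
    then show "((\<lambda>x. wb j (t1 + x)) has_vector_derivative flow_field a (\<lambda>k. wb k (t1 + x)) j) (at x)"
      by (rule shift)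
    show "((\<lambda>x. exp (\<i> * of_real (\<gamma> j)) * w j (t0 + x)) has_vector_derivative
        flow_field a (\<lambda>k. exp (\<i> * of_real (\<gamma> k)) * w k (t0 + x)) j) (at x)"
      by (rule shift[OF rotated_solution[OF \<gamma> ox(2)]])
    show "cmod (wb j (t1 + x)) \<le> sqrt CARD('m)"
      unfolding wb(2)[OF ox(1)] by (rule w_bounded[OF ox(1)])
    show "cmod (exp (\<i> * of_real (\<gamma> j)) * w j (t0 + x)) \<le> sqrt CARD('m)"
      using w_bounded[OF ox(2)] by (simp add: norm_mult)
  qed
qed

text \<open>Because \<open>B\<close> is integral, changing an angular coordinate by a multiple of
  \<open>2 * pi\<close> changes every phase by such a multiple. Parameters can thus be kept in a
  bounded range of angles without moving the image.\<close>

lemma reduce_angles: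
  obtains y where "y $ p = x $ p" "y $ q = x $ q" "\<Phi> y = \<Phi> x"
    "\<And>i. i \<noteq> p \<Longrightarrow> i \<noteq> q \<Longrightarrow> y $ i \<in> {0..2*pi}"
proof
  define n where "n i = (if i = p \<or> i = q then 0 else \<lfloor>x $ i / (2 * pi)\<rfloor>)" for i
  define y :: "real ^ 'm" where "y = (\<chi> i. x $ i - 2 * pi * of_int (n i))"
  show "y $ p = x $ p" "y $ q = x $ q" by (auto simp: y_def n_def)
  show "y $ i \<in> {0..2*pi}" if "i \<noteq> p" "i \<noteq> q" for i
  proof -
    have "x $ i = x $ i / (2 * pi) * (2 * pi)" by simp
    moreover have "of_int (n i) \<le> x $ i / (2 * pi)" "x $ i / (2 * pi) \<le> of_int (n i) + 1"
      using that by (auto simp: n_def)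
    ultimately show ?thesis
      by (simp add: y_def field_simps)
  qed
  have "exp (Lin j y) = exp (Lin j x)" for j
  proof -
    define N where "N = (\<Sum>i\<in>UNIV. n i * B i j)"
    have "ph x j - 2 * of_int N * pi = ph y j"
      unfolding ph_def N_def y_def vec_lambda_beta left_diff_distrib sum_subtractf of_int_sum
        sum_distrib_left sum_distrib_right by (simp add: mult_ac)
    then have "ph x j = ph y j + 2 * of_int N * pi" by simp
    then have "Lin j x = Lin j y + 2 * of_int N * of_real pi * \<i>"
      by (simp add: Lin_def \<open>y $ p = x $ p\<close> algebra_simps)
    then show ?thesis using exp_integer_2pi[of "of_int N"] by (simp add: exp_add)
  qed
  then show "\<Phi> y = \<Phi> x" by (simp add: \<Phi>_def \<open>y $ q = x $ q\<close>)
qed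

lemma Lin_continuous: "continuous_on S (Lin j)"
  by (intro continuous_at_imp_continuous_on ballI has_derivative_continuous[OF Lin_has_derivative])

text \<open>
  This is what makes the image embedded and not only immersed. After reducing the angles modulo
  \<open>2\<pi>\<close>, a sequence of parameters whose images tend to \<open>\<Phi> x0\<close> subconverges to a parameter
  \<open>x1\<close> (possibly with boundary time) over the same point; uniqueness for the flow then shows that
  translating the sequence by \<open>x0 - x1\<close> does not change the images.
\<close>

lemma image_near_point:
  assumes x0: "x0 \<in> D" and "\<delta> > 0"
  obtains U where "open U" "\<Phi> x0 \<in> U" "\<Phi> ` D \<inter> U \<subseteq> \<Phi> ` (D \<inter> ball x0 \<delta>)"
proof (rule ccontr)
  assume neg: "\<not> thesis"
  have "\<exists>y\<in>D. dist (\<Phi> x0) (\<Phi> y) < inverse (Suc n) \<and> \<Phi> y \<notin> \<Phi> ` (D \<inter> ball x0 \<delta>) \<and>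
      (\<forall>i. i \<noteq> p \<longrightarrow> i \<noteq> q \<longrightarrow> y $ i \<in> {0..2*pi})" for n
  proof -
    have "\<not> \<Phi> ` D \<inter> ball (\<Phi> x0) (inverse (Suc n)) \<subseteq> \<Phi> ` (D \<inter> ball x0 \<delta>)"
      using that[of "ball (\<Phi> x0) (inverse (Suc n))"] neg by auto
    then obtain y' where y': "y' \<in> D" "\<Phi> y' \<in> ball (\<Phi> x0) (inverse (Suc n))"
      "\<Phi> y' \<notin> \<Phi> ` (D \<inter> ball x0 \<delta>)" by blast
    obtain y where "y $ p = y' $ p" "y $ q = y' $ q" "\<Phi> y = \<Phi> y'"
      "\<And>i. i \<noteq> p \<Longrightarrow> i \<noteq> q \<Longrightarrow> y $ i \<in> {0..2*pi}"
      using reduce_angles[of y'] by blast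
    with y' show ?thesis by (intro bexI[of _ y]) (auto simp: D_def simp del: of_nat_Suc)
  qed
  then obtain y where y: "\<And>n. y n \<in> D" "\<And>n. dist (\<Phi> x0) (\<Phi> (y n)) < inverse (Suc n)"
    "\<And>n. \<Phi> (y n) \<notin> \<Phi> ` (D \<inter> ball x0 \<delta>)"
    "\<And>n i. i \<noteq> p \<Longrightarrow> i \<noteq> q \<Longrightarrow> y n $ i \<in> {0..2*pi}"
    by metis
  have \<Phi>y: "(\<lambda>n. \<Phi> (y n)) \<longlonglongrightarrow> \<Phi> x0"
  proof (rule metric_tendsto_imp_tendsto[OF LIMSEQ_inverse_real_of_nat])
    show "\<forall>\<^sub>F n in sequentially. dist (\<Phi> (y n)) (\<Phi> x0) \<le> dist (inverse (real (Suc n))) 0"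
      using y(2) by (auto intro!: always_eventually less_imp_le simp: dist_commute)
  qed
  have m: "sqrt (real CARD('m)) > 0" by simp
  \<comment> \<open>Convergence of the images forces convergence of the radial coordinates, which
    bounds the only coordinate not yet bounded.\<close>
  have radial: "\<sigma> * ln (norm (\<Phi> x) / sqrt CARD('m)) = x $ p" if "x \<in> D" for x
    unfolding norm_\<Phi>[OF that] using sigma m by auto
  have "(\<lambda>n. \<sigma> * ln (norm (\<Phi> (y n)) / sqrt CARD('m))) \<longlonglongrightarrow> \<sigma> * ln (norm (\<Phi> x0) / sqrt CARD('m))"
    using norm_\<Phi>[OF x0] by (intro tendsto_intros \<Phi>y) auto
  then have yp: "(\<lambda>n. y n $ p) \<longlonglongrightarrow> x0 $ p"
    by (simp add: radial y(1) x0)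
  then have "Bseq (\<lambda>n. y n $ p)" by (metis convergentI convergent_imp_Bseq)
  then obtain R where R: "\<And>n. \<bar>y n $ p\<bar> \<le> R" by (auto simp: Bseq_def)
  have "norm (y n) \<le> (\<Sum>i\<in>(UNIV::'m set). \<bar>R\<bar> + \<epsilon> + 2 * pi)" for n
  proof (rule order_trans[OF norm_le_l1_cart], rule sum_mono)
    fix i
    consider "i = p" | "i = q" | "i \<noteq> p" "i \<noteq> q" by blast
    then have "\<bar>y n $ i\<bar> \<le> R \<or> \<bar>y n $ i\<bar> \<le> \<epsilon> \<or> \<bar>y n $ i\<bar> \<le> 2 * pi"
      using R[of n] y(1)[of n] y(4)[of i n] by cases (auto simp: D_def)
    then show "\<bar>y n $ i\<bar> \<le> \<bar>R\<bar> + \<epsilon> + 2 * pi" using eps pi_gt_zero by linarith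
  qed
  then have "bounded (range y)" by (auto simp: bounded_iff)
  then obtain x1 r where r: "strict_mono r" "(y \<circ> r) \<longlonglongrightarrow> x1"
    using bounded_imp_convergent_subsequence by metis
  define z where "z n = y (r n)" for n
  have z: "z \<longlonglongrightarrow> x1" using r(2) by (simp add: z_def[abs_def] o_def)
  have zD: "z n \<in> D" for n using y(1) by (simp add: z_def)
  have zp: "(\<lambda>n. z n $ p) \<longlonglongrightarrow> x0 $ p"
    using LIMSEQ_subseq_LIMSEQ[OF yp r(1)] by (simp add: z_def o_def)
  have x1p: "x1 $ p = x0 $ p"
    by (rule LIMSEQ_unique[OF tendsto_vec_nth[OF z] zp])
  have zI: "z n $ q \<in> {-\<epsilon>..\<epsilon>}" for n using zD[of n] by (auto simp: D_def)
  have x1q: "x1 $ q \<in> {-\<epsilon>..\<epsilon>}"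
    by (rule closed_sequentially[OF closed_atLeastAtMost _ tendsto_vec_nth[OF z]]) (rule zI)
  obtain wb where wb: "\<And>j. continuous_on {-\<epsilon>..\<epsilon>} (wb j)"
    "\<And>j t. t \<in> {-\<epsilon><..<\<epsilon>} \<Longrightarrow> wb j t = w j t"
    using w_extends by blast
  have wz: "wb j (z n $ q) = w j (z n $ q)" for j n using zD[of n] wb(2) by (simp add: D_def)
  \<comment> \<open>The radial coordinates of \<open>x0\<close> and \<open>x1\<close> coincide, so
    the two points of the curve over the limit differ by a pure phase.\<close>
  define \<gamma> where "\<gamma> j = ph (x0 - x1) j" for j
  have exp\<gamma>: "exp (Lin j (x0 - x1)) = exp (\<i> * of_real (\<gamma> j))" for j
    by (simp add: Lin_def x1p \<gamma>_def)
  have init: "wb j (x1 $ q) = exp (\<i> * of_real (\<gamma> j)) * w j (x0 $ q)" for j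
  proof -
    have "(\<lambda>n. Lin j (z n)) \<longlonglongrightarrow> Lin j x1"
      using continuous_on_tendsto_compose[OF Lin_continuous[of UNIV j] z] by simp
    moreover have "(\<lambda>n. wb j (z n $ q)) \<longlonglongrightarrow> wb j (x1 $ q)"
      using continuous_on_tendsto_compose[OF wb(1) tendsto_vec_nth[OF z] x1q] zI by simp
    ultimately have lim1: "(\<lambda>n. exp (Lin j (z n)) * wb j (z n $ q)) \<longlonglongrightarrow> exp (Lin j x1) * wb j (x1 $ q)"
      by (intro tendsto_intros)
    have "(\<lambda>n. \<Phi> (z n) $ j) \<longlonglongrightarrow> \<Phi> x0 $ j"
      using LIMSEQ_subseq_LIMSEQ[OF tendsto_vec_nth[OF \<Phi>y] r(1), of j] by (simp add: z_def o_def)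
    moreover have "\<Phi> (z n) $ j = exp (Lin j (z n)) * wb j (z n $ q)" for n
      by (simp add: \<Phi>_def wz)
    ultimately have "(\<lambda>n. exp (Lin j (z n)) * wb j (z n $ q)) \<longlonglongrightarrow> \<Phi> x0 $ j"
      by simp
    with lim1 have "exp (Lin j x1) * wb j (x1 $ q) = \<Phi> x0 $ j"
      by (rule LIMSEQ_unique)
    also have "\<dots> = exp (Lin j x1) * (exp (\<i> * of_real (\<gamma> j)) * w j (x0 $ q))"
      using Lin_add[of j x1 "x0 - x1"] by (simp add: \<Phi>_def exp_add flip: exp\<gamma>)
    finally show ?thesis by simp
  qed
  have "(\<lambda>n. z n + (x0 - x1)) \<longlonglongrightarrow> x1 + (x0 - x1)" by (intro tendsto_intros z)
  then have lim: "(\<lambda>n. z n + (x0 - x1)) \<longlonglongrightarrow> x0" by simp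
  have "open (D \<inter> ball x0 \<delta>)" "x0 \<in> D \<inter> ball x0 \<delta>" using open_D x0 \<open>\<delta> > 0\<close> by auto
  from topological_tendstoD[OF lim this] obtain n where n: "z n + (x0 - x1) \<in> D \<inter> ball x0 \<delta>"
    by (auto simp: eventually_sequentially)
  have "\<Phi> (z n + (x0 - x1)) = \<Phi> (z n)"
  proof -
    have "wb j (x1 $ q + (z n $ q - x1 $ q)) = exp (\<i> * of_real (\<gamma> j)) * w j (x0 $ q + (z n $ q - x1 $ q))" for j
    proof (rule flow_recurrence[OF wb _ x1q _ _ _ init])
      show "(\<Sum>j\<in>UNIV. \<gamma> j) = 0" by (simp add: \<gamma>_def sum_ph)
    qed (use x0 n zI[of n] in \<open>auto simp: D_def algebra_simps\<close>)
    then have "w j (z n $ q) = exp (\<i> * of_real (\<gamma> j)) * w j ((z n + (x0 - x1)) $ q)" for j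
      by (simp add: wz algebra_simps)
    then show ?thesis
      by (simp add: \<Phi>_def Lin_add exp_add exp\<gamma> mult.assoc)
  qed
  then have "\<Phi> (z n) \<in> \<Phi> ` (D \<inter> ball x0 \<delta>)" using n by (metis imageI)
  then show False using y(3) by (simp add: z_def)
qed

lemma \<Phi>_continuous: "continuous_on D \<Phi>"
  by (intro continuous_at_imp_continuous_on ballI has_derivative_continuous[OF \<Phi>_has_derivative])

lemma chart_\<Phi>:
  assumes x0: "x0 \<in> D"
  obtains V where "x0 \<in> V" "V \<subseteq> D" "chart (\<Phi> ` D) \<Phi> V"
proof -
  have Dn: "eventually (\<lambda>x. x \<in> D) (nhds x0)" using open_D x0 by (rule eventually_nhds_in_open)
  have cw: "isCont (\<lambda>x. w k (x $ q)) x0" for k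
    using w_has_derivative[OF x0] by (rule has_derivative_continuous)
  have "isCont (\<lambda>x. frechet_derivative \<Phi> (at x) (axis i 1)) x0" for i
  proof -
    have "continuous (at x0) (\<lambda>x. \<chi> j. \<Phi> x $ j * Q x i * of_real (C (x $ q) $ j $ i))"
    proof -
      have "isCont \<Phi> x0" using \<Phi>_has_derivative[OF x0] by (rule has_derivative_continuous)
      moreover have "isCont (\<lambda>x. Q x i) x0"
        unfolding Q_def W_def by (cases "i = p"; cases "i = q") (auto intro!: continuous_intros cw)
      moreover have "isCont (\<lambda>x. C (x $ q) $ j $ i) x0" for j
        using w_nz[of "x0 $ q" j] x0 unfolding C_def
        by (cases "i = p"; cases "i = q") (auto simp: D_def intro!: continuous_intros cw)
      ultimately show ?thesis
        unfolding isCont_def 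
        by (intro tendsto_vec_lambda tendsto_mult tendsto_of_real) (auto intro: tendsto_vec_nth)
    qed
    moreover have "eventually (\<lambda>x. (\<chi> j. \<Phi> x $ j * Q x i * of_real (C (x $ q) $ j $ i)) =
        frechet_derivative \<Phi> (at x) (axis i 1)) (nhds x0)"
      using Dn by eventually_elim (simp add: vec_eq_iff frame_\<Phi> flip: frame_def)
    ultimately show ?thesis using isCont_cong by force
  qed
  moreover have "(\<Phi> has_derivative frechet_derivative \<Phi> (at x)) (at x)" if "x \<in> D" for x
    unfolding frechet_derivative_at[OF \<Phi>_has_derivative[OF that], symmetric]
    by (rule \<Phi>_has_derivative[OF that])
  ultimately obtain \<rho> where \<rho>: "\<rho> > 0" "ball x0 \<rho> \<subseteq> D" "inj_on \<Phi> (ball x0 \<rho>)"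
    using immersion_locally_injective[OF open_D x0, of \<Phi> "\<lambda>x. frechet_derivative \<Phi> (at x)"]
      inj_derivative_\<Phi>[OF x0] by blast
  \<comment> \<open>Halving puts a closed, hence compact, ball inside the ball of
    injectivity.\<close>
  define \<delta> where "\<delta> = \<rho> / 2"
  have \<delta>: "\<delta> > 0" "cball x0 \<delta> \<subseteq> ball x0 \<rho>" using \<rho>(1) by (auto simp: \<delta>_def)
  obtain U where U: "open U" "\<Phi> x0 \<in> U" "\<Phi> ` D \<inter> U \<subseteq> \<Phi> ` (D \<inter> ball x0 \<delta>)"
    using image_near_point[OF x0 \<delta>(1)] by blast
  obtain \<psi> where \<psi>: "homeomorphism (cball x0 \<delta>) (\<Phi> ` cball x0 \<delta>) \<Phi> \<psi>"
    using homeomorphism_compact[of "cball x0 \<delta>" \<Phi>] \<delta> \<rho> \<Phi>_continuous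
    by (meson compact_cball continuous_on_subset inj_on_subset)
  define V where "V = ball x0 \<delta> \<inter> (D \<inter> \<Phi> -` U)"
  have VD: "V \<subseteq> D" by (auto simp: V_def)
  have "open V"
    unfolding V_def using continuous_open_preimage[OF \<Phi>_continuous open_D U(1)] by auto
  have img: "\<Phi> ` V = \<Phi> ` D \<inter> U"
    using U(3) by (auto simp: V_def)
  have "homeomorphism V (\<Phi> ` D \<inter> U) \<Phi> \<psi>"
    by (rule homeomorphism_of_subsets[OF \<psi> _ _ img, of "{}"]) (auto simp: V_def)
  then have "chart (\<Phi> ` D) \<Phi> V"
    unfolding chart_def using \<open>open V\<close> VD smooth_\<Phi>[OF \<open>open V\<close> VD] inj_derivative_\<Phi> U(1) by blast
  moreover have "x0 \<in> V" using x0 U(2) \<delta>(1) by (simp add: V_def)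
  ultimately show ?thesis using VD that by blast
qed

section \<open>Atlas and choice of orientation\<close>

lemma special_lagrangian_image:
  assumes pos: "\<And>t. t \<in> {-\<epsilon><..<\<epsilon>} \<Longrightarrow> det (C t) > 0"
  shows "special_lagrangian (\<Phi> ` D) (\<i> ^ (CARD('m) - 2))"
proof -
  define \<theta> where "\<theta> = real (CARD('m) - 2) * (pi / 2)"
  have "exp (\<i> * of_real \<theta>) = exp (of_nat (CARD('m) - 2) * (\<i> * of_real (pi / 2)))"
    by (simp add: \<theta>_def mult_ac)
  also have "\<dots> = \<i> ^ (CARD('m) - 2)"
    unfolding exp_of_nat_mult cis_conv_exp[symmetric] by (simp add: cis_pi_half)
  finally have \<theta>: "\<i> ^ (CARD('m) - 2) = exp (\<i> * of_real \<theta>)" ..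
  \<comment> \<open>All charts are restrictions of the single map \<open>\<Phi>\<close>. Frames over
    a common point therefore coincide, and the identity matrix serves as transition matrix.\<close>
  define A where "A = {(\<Phi>, V) | V. V \<subseteq> D \<and> chart (\<Phi> ` D) \<Phi> V}"
  have "oriented_atlas (\<Phi> ` D) A"
    unfolding oriented_atlas_def
  proof (intro conjI)
    show "\<forall>(\<phi>, V)\<in>A. chart (\<Phi> ` D) \<phi> V" by (auto simp: A_def)
    show "\<forall>y\<in>\<Phi> ` D. \<exists>(\<phi>, V)\<in>A. y \<in> \<phi> ` V"
    proof safe
      fix x assume "x \<in> D"
      then obtain V where V: "x \<in> V" "V \<subseteq> D" "chart (\<Phi> ` D) \<Phi> V" using chart_\<Phi> by blast
      then show "\<exists>(\<phi>, V)\<in>A. \<Phi> x \<in> \<phi> ` V"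
        by (intro bexI[of _ "(\<Phi>, V)"]) (auto simp: A_def)
    qed
    have "\<exists>M::real^'m^'m. det M > 0 \<and> (\<forall>i. frame \<Phi> x i = (\<Sum>j\<in>UNIV. (M $ i $ j) *\<^sub>R frame \<Phi> y j))"
      if "x \<in> D" "y \<in> D" "\<Phi> x = \<Phi> y" for x y
    proof (intro exI[of _ "mat 1"] conjI allI)
      fix i
      have "(mat 1 $ i $ j) *\<^sub>R frame \<Phi> y j = (if j = i then frame \<Phi> y i else 0)" for j
        by (simp add: mat_def)
      then show "frame \<Phi> x i = (\<Sum>j\<in>UNIV. (mat 1 $ i $ j) *\<^sub>R frame \<Phi> y j)"
        using frame_determined_by_point[OF that] by simp
    qed simp
    then show "\<forall>(\<phi>1, V1)\<in>A. \<forall>(\<phi>2, V2)\<in>A. \<forall>x1\<in>V1. \<forall>x2\<in>V2. \<phi>1 x1 = \<phi>2 x2 \<longrightarrow>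
        (\<exists>M::real^'m^'m. det M > 0 \<and>
           (\<forall>i. frame \<phi>1 x1 i = (\<Sum>j\<in>UNIV. (M $ i $ j) *\<^sub>R frame \<phi>2 x2 j)))"
      unfolding A_def by blast
  qed
  moreover have "cos \<theta> * Re (holo_vol (frame \<Phi> x)) + sin \<theta> * Im (holo_vol (frame \<Phi> x)) =
      induced_vol (frame \<Phi> x)" if "x \<in> D" for x
  proof (rule calibrated_Lagrangian[OF frame_Lagrangian[OF that]])
    show "holo_vol (frame \<Phi> x) = of_real (vol x) * exp (\<i> * of_real \<theta>)"
      using holo_vol_\<Phi>[OF that] \<theta> by simp
    show "vol x \<ge> 0"
      using pos[of "x $ q"] that by (simp add: vol_def D_def less_imp_le)
  qed
  ultimately have "special_lagrangian_theta (\<Phi> ` D) \<theta>"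
    unfolding special_lagrangian_theta_def by (intro exI[of _ A]) (auto simp: A_def)
  then show ?thesis using \<theta> unfolding special_lagrangian_def by blast
qed

end

text \<open>Reversing \<open>\<sigma>\<close> negates column \<open>p\<close> only. This reverses
  the orientation, so one of the two signs always gives a positive determinant.\<close>

lemma sl_flow_det_flip:
  assumes "sl_flow a \<epsilon> w u p q 1"
  shows "det (sl_flow.C a w p q (-1) t) = - det (sl_flow.C a w p q 1 t)"
proof -
  interpret P: sl_flow a \<epsilon> w u p q 1 by (rule assms)
  interpret M: sl_flow a \<epsilon> w u p q "-1"
    using assms unfolding sl_flow_def by simp
  have "M.C t = (\<chi> j i. 1 * (if i = p then -1 else 1) * P.C t $ j $ i)"
    by (simp add: vec_eq_iff M.C_def P.C_def)
  then show ?thesis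
    using det_scale_rows_columns[of "\<lambda>_. 1" "\<lambda>i. if i = p then -1 else 1" "P.C t"] by simp
qed

theorem theorem7p1:
  fixes a :: "'m::finite \<Rightarrow> int"
    and \<epsilon> :: real
    and w :: "'m \<Rightarrow> real \<Rightarrow> complex"
    and u :: "real \<Rightarrow> real"
  assumes m3: "CARD('m) \<ge> 3"
    and a_sorted: "\<exists>e. bij_betw e {1..CARD('m)} (UNIV::'m set) \<and> mono_on {1..CARD('m)} (a \<circ> e)"
    and a_nonzero: "\<exists>j. a j \<noteq> 0"
    and a_hcf: "Gcd (range a) = 1"
    and a_sum: "(\<Sum>j\<in>UNIV. a j) = 0"
    and eps: "\<epsilon> > 0"
    and w_diff: "\<forall>j. \<forall>t\<in>{-\<epsilon><..<\<epsilon>}. w j differentiable (at t)"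
    and w_nz: "\<forall>j. \<forall>t\<in>{-\<epsilon><..<\<epsilon>}. w j t \<noteq> 0"
    and u_diff: "\<forall>t\<in>{-\<epsilon><..<\<epsilon>}. u differentiable (at t)"
  shows
   "((\<forall>t\<in>{-\<epsilon><..<\<epsilon>}.
        (\<forall>j. (w j has_vector_derivative (of_int (a j) * cnj (\<Prod>k\<in>UNIV-{j}. w k t))) (at t)) \<and>
        (u has_real_derivative (2 * Re (\<Prod>k\<in>UNIV. w k t))) (at t)) \<and>
     (\<forall>j. (cmod (w j 0))\<^sup>2 = of_int (a j) * u 0 + 1)
     \<longrightarrow> (\<forall>t\<in>{-\<epsilon><..<\<epsilon>}. \<forall>j. (cmod (w j t))\<^sup>2 = of_int (a j) * u t + 1))
    \<and>
    ((\<forall>t\<in>{-\<epsilon><..<\<epsilon>}.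
        (\<forall>j. (w j has_vector_derivative (of_int (a j) * cnj (\<Prod>k\<in>UNIV-{j}. w k t))) (at t)) \<and>
        (u has_real_derivative (2 * Re (\<Prod>k\<in>UNIV. w k t))) (at t) \<and>
        (\<forall>j. (cmod (w j t))\<^sup>2 = of_int (a j) * u t + 1))
     \<longrightarrow> special_lagrangian
           {(\<chi> j. of_real r * exp (\<i> * of_real (\<alpha> j)) * w j t) | r t \<alpha>.
              r > 0 \<and> t \<in> {-\<epsilon><..<\<epsilon>} \<and> (\<Sum>j\<in>UNIV. \<alpha> j) = 0 \<and>
              (\<Sum>j\<in>UNIV. of_int (a j) * \<alpha> j) = 0}
           (\<i> ^ (CARD('m) - 2)))"
proof (intro conjI impI, goal_cases)
  case 1
  then show ?case
    using flow_conservation[of \<epsilon> w a u] unfolding flow_field_def by blast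
next
  case 2
  \<comment> \<open>Equal weights with sum zero would all vanish.\<close>
  obtain p q where "a p \<noteq> a q"
  proof (rule ccontr)
    assume "\<not> thesis"
    then have "a j = a k" for j k using that by blast
    then obtain c where "\<And>j. a j = c" by blast
    then show False using a_sum a_nonzero by simp
  qed
  then have flow: "sl_flow a \<epsilon> w u p q \<sigma>" if "\<sigma> = 1 \<or> \<sigma> = -1" for \<sigma>
    using that a_sum eps w_nz 2 unfolding sl_flow_def flow_field_def by auto
  interpret P: sl_flow a \<epsilon> w u p q 1 using flow by simp
  interpret M: sl_flow a \<epsilon> w u p q "-1" using flow by simp
  \<comment> \<open>By \<open>image_\<Phi>\<close> both signs parametrize the same set, so the sign
    may be chosen to make the determinant positive.\<close>
  show ?case
  proof (cases "\<forall>t\<in>{-\<epsilon><..<\<epsilon>}. det (P.C t) > 0")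
    case True
    then show ?thesis
      using P.special_lagrangian_image unfolding P.image_\<Phi> by blast
  next
    case False
    then have "\<forall>t\<in>{-\<epsilon><..<\<epsilon>}. det (M.C t) > 0"
      using P.det_C_sign sl_flow_det_flip[OF P.sl_flow_axioms] by auto
    then show ?thesis
      using M.special_lagrangian_image unfolding M.image_\<Phi> by blast
  qed
qed

end
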